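(* Let $\mathcal{B}$ be an integer matrix that is $\mathcal{A}$-graded by $\phi$, and let $\mathcal{G}$ be a Markov basis of the family of all intersected projected fibers $$\Big\{\bigcap_{i=1}^{r}\phi(F(\mathcal{B},b_i)) : r\ge 1,\ b_1,\dots,b_r\in\mathbb{N}\mathcal{B}\Big\}.$$ If $\mathcal{G}$ is finite, then there is a constant $C>0$ such that $\operatorname{mardeg}\big(\times_{\mathcal{A}}^{r}\mathcal{B}\big)\le C$ for any $r>0$.
   Context: $\mathbb{N}=\{0,1,\dots\}$. Let $\mathcal{A}\in\mathbb{Z}^{s\times t}$ be an integer matrix and $\mathcal{B}$ an integer matrix with $n$ columns $b_1,\dots,b_n$. A surjection $\phi:[n]\to[t]$ induces the linear map $\phi:\mathbb{Z}^n\to\mathbb{Z}^t$, $e_i\mapsto e_{\phi(i)}$. $\mathcal{B}$ is $\mathcal{A}$-graded by $\phi$ if $\phi(\ker_{\mathbb{Z}}\mathcal{B})\subseteq\ker_{\mathbb{Z}}\mathcal{A}$. The $r$-fold toric fiber power $\times_{\mathcal{A}}^{r}\mathcal{B}$ is the matrix whose columns are the stacked vectors $(b_{i_1};\dots;b_{i_r})$, one for each tuple $(i_1,\dots,i_r)\in[n]^r$ with $\phi(i_1)=\dots=\phi(i_r)$. $\mathbb{N}\mathcal{B}$ is the affine semigroup generated by the columns of $\mathcal{B}$, and $F(\mathcal{B},b)=\{v\in\mathbb{N}^n:\mathcal{B}v=b\}$. A set $\mathcal{M}\subseteq\mathbb{Z}^n$ is a Markov basis of a family $\mathcal{F}$ of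 subsets of $\mathbb{Z}^n$ if for each $F\in\mathcal{F}$ the undirected graph on $F$ in which $u,v$ are adjacent iff $u-v\in\pm\mathcal{M}$ is connected. For $v\in\mathbb{Z}^n$ with decomposition $v=v^+-v^-$ into positive and negative part, $\deg(v)=\max\{\|v^+\|_1,\|v^-\|_1\}$; $\deg(\mathcal{M})=\sup_{v\in\mathcal{M}}\deg(v)$. For a matrix $\mathcal{B}$, $\operatorname{mardeg}(\mathcal{B})$ is the minimum of $\deg(\mathcal{M})$ over all Markov bases $\mathcal{M}$ of the family $\{F(\mathcal{B},b)\}_b$ of all fibers of $\mathcal{B}$. *)

theory Defs
  imports
    "Jordan_Normal_Form.Matrix"
    "Jordan_Normal_Form.Matrix_Kernel"
    "HOL-Library.Extended_Nat"
begin

text \<open>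
  All index sets are 0-based: the columns of a matrix \<open>B\<close> are indexed by \<open>{..<dim_col B}\<close>, and a
  surjection \<open>[n] \<rightarrow> [t]\<close> is a function \<open>\<phi> :: nat \<Rightarrow> nat\<close> with \<open>\<phi> ` {..<n} = {..<t}\<close>.
  Only the values of \<open>\<phi>\<close> below \<open>n\<close> matter.
\<close>

text \<open>\<open>\<nat>\<^sup>n\<close>, as a subset of \<open>\<int>\<^sup>n\<close>; the order on vectors is componentwise.\<close>

definition nonneg_vecs :: "nat \<Rightarrow> int vec set" where
  "nonneg_vecs n = {v \<in> carrier_vec n. 0\<^sub>v n \<le> v}"

definition affine_semigroup :: "int mat \<Rightarrow> int vec set" where
  "affine_semigroup B = {B *\<^sub>v v | v. v \<in> nonneg_vecs (dim_col B)}"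

definition fiber :: "int mat \<Rightarrow> int vec \<Rightarrow> int vec set" where
  "fiber B b = {v \<in> nonneg_vecs (dim_col B). B *\<^sub>v v = b}"

text \<open>The linear map \<open>\<int>\<^sup>n \<rightarrow> \<int>\<^sup>t\<close> sending \<open>e\<^sub>i\<close> to \<open>e\<^bsub>\<phi> i\<^esub>\<close>, where \<open>n\<close> is the dimension of the argument.\<close>

definition induced_map :: "nat \<Rightarrow> (nat \<Rightarrow> nat) \<Rightarrow> int vec \<Rightarrow> int vec" where
  "induced_map t \<phi> v = mat_of_cols t (map (\<lambda>i. unit_vec t (\<phi> i)) [0..<dim_vec v]) *\<^sub>v v"

definition graded_by :: "int mat \<Rightarrow> (nat \<Rightarrow> nat) \<Rightarrow> int mat \<Rightarrow> bool" where
  "graded_by A \<phi> B \<longleftrightarrow> induced_map (dim_col A) \<phi> ` mat_kernel B \<subseteq> mat_kernel A"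

text \<open>
  The tuples in \<open>[n]\<^sup>r\<close> with constant \<open>\<phi>\<close>-value, each listed exactly once, as lists of length \<open>r\<close>.
  Their order (lexicographic) fixes the order of the columns of the fiber power.
\<close>

definition fiber_tuples :: "(nat \<Rightarrow> nat) \<Rightarrow> nat \<Rightarrow> nat \<Rightarrow> nat list list" where
  "fiber_tuples \<phi> r n =
     filter (\<lambda>is. \<forall>i\<in>set is. \<forall>j\<in>set is. \<phi> i = \<phi> j) (List.n_lists r [0..<n])"

definition stacked_cols :: "int mat \<Rightarrow> nat list \<Rightarrow> int vec" where
  "stacked_cols B is = foldr (\<lambda>i w. col B i @\<^sub>v w) is (0\<^sub>v 0)"

definition toric_fiber_power :: "(nat \<Rightarrow> nat) \<Rightarrow> nat \<Rightarrow> int mat \<Rightarrow> int mat" where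
  "toric_fiber_power \<phi> r B =
     mat_of_cols (r * dim_row B) (map (stacked_cols B) (fiber_tuples \<phi> r (dim_col B)))"

definition fiber_graph :: "int vec set \<Rightarrow> int vec set \<Rightarrow> (int vec \<times> int vec) set" where
  "fiber_graph M F = {(u, v). u \<in> F \<and> v \<in> F \<and> u - v \<in> M \<union> uminus ` M}"

text \<open>The graph on the empty set counts as connected.\<close>

definition markov_basis :: "nat \<Rightarrow> int vec set set \<Rightarrow> int vec set \<Rightarrow> bool" where
  "markov_basis n \<F> M \<longleftrightarrow>
     M \<subseteq> carrier_vec n \<and> (\<forall>F\<in>\<F>. \<forall>u\<in>F. \<forall>v\<in>F. (u, v) \<in> (fiber_graph M F)\<^sup>*)"

definition all_fibers :: "int mat \<Rightarrow> int vec set set" where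
  "all_fibers B = fiber B ` affine_semigroup B"

definition intersected_projected_fibers ::
  "nat \<Rightarrow> (nat \<Rightarrow> nat) \<Rightarrow> int mat \<Rightarrow> int vec set set" where
  "intersected_projected_fibers t \<phi> B =
     {\<Inter>i\<in>{..<r}. induced_map t \<phi> ` fiber B (b i) | (r :: nat) b.
        r \<ge> 1 \<and> (\<forall>i<r. b i \<in> affine_semigroup B)}"

text \<open>Since \<open>nat\<close> truncates negative integers to 0, the two sums are \<open>\<parallel>v\<^sup>+\<parallel>\<^sub>1\<close> and \<open>\<parallel>v\<^sup>-\<parallel>\<^sub>1\<close>.\<close>

definition vec_deg :: "int vec \<Rightarrow> nat" where
  "vec_deg v = max (\<Sum>i<dim_vec v. nat (v $ i)) (\<Sum>i<dim_vec v. nat (- (v $ i)))"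

definition set_deg :: "int vec set \<Rightarrow> enat" where
  "set_deg M = (SUP v\<in>M. enat (vec_deg v))"

text \<open>The infimum in \<open>enat\<close> of a nonempty set is a minimum, since \<open>enat\<close> is well-ordered.\<close>

definition mardeg :: "int mat \<Rightarrow> enat" where
  "mardeg B = Inf {set_deg M | M. markov_basis (dim_col B) (all_fibers B) M}"

end

theory Submission
  imports Defs "HOL-Library.Function_Algebras"
begin

text \<open>
  A point of a fiber of the \<open>r\<close>-fold fiber power is a multiset of \<open>r\<close>-tuples, that is, a table whose
  rows are constant under \<open>\<phi>\<close>. Being in a given fiber only constrains the columns of the table: column
  \<open>k\<close> is a point of a fiber of \<open>B\<close>, and all columns have the same image under \<open>\<phi>\<close>, the class
  multiset of the table. The class multisets that occur are exactly the points of the intersection of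
  the projected fibers of the columns. Two tables in the same fiber are joined in three stages, each
  by moves whose degree does not depend on \<open>r\<close>.

  The class multisets of the two tables are joined by a path along the finite set \<open>G\<close>. An edge \<open>g\<close> of
  this path says that every column can change its classes by \<open>g\<close> within its fiber. By Dickson's lemma
  a replacement of boundedly many entries of the column achieves this (\<open>bounded_lift\<close>), and there are
  finitely many \<open>g\<close>, so one bound serves all of them. Once the class multisets agree, the
  columns are made equal by replacements of bounded size that keep the classes, again by Dickson's lemma
  (\<open>bounded_nonempty_part\<close>, \<open>equal_classes_connected\<close>). Finally, tables with equal columns are joined by
  exchanging entries between two rows of the same class (\<open>equal_columns_connected\<close>).

  The independence of \<open>r\<close> rests on \<open>replace_in_all_columns\<close>: replacements of size at most \<open>D\<close> in all
  columns are carried out at once by changing a number of rows that depends only on \<open>D\<close> and the number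
  of classes. To this end the parts to be replaced are enlarged to parts with a common class multiset,
  which may be taken to have at most \<open>D\<close> elements in each class, and are gathered in few rows by
  exchanges.
\<close>

section \<open>Dickson's lemma for pairs of multisets\<close>

text \<open>
  This is the combinatorial core of Dickson's lemma, obtained by treating one element of \<open>I\<close> at a
  time: a sequence of natural numbers has a monotone subsequence, and if that subsequence decreases,
  it is constant from the position \<open>m\<close> of its minimum on.
\<close>

lemma monotone_subsequence_of_multisets:
  fixes f :: "nat \<Rightarrow> 'a multiset"
  assumes "finite I" and "\<And>i. set_mset (f i) \<subseteq> I"
  shows "\<exists>g :: nat \<Rightarrow> nat. strict_mono g \<and> (\<forall>i j. i \<le> j \<longrightarrow> f (g i) \<subseteq># f (g j))"
proof -
  have "\<exists>g::nat \<Rightarrow> nat. strict_mono g \<and> (\<forall>a\<in>I. \<forall>i j. i \<le> j \<longrightarrow> count (f (g i)) a \<le> count (f (g j)) a)"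
    using assms(1)
  proof induction
    case empty
    show ?case by (intro exI[of _ id]) (simp add: strict_mono_def)
  next
    case (insert a J)
    from insert.IH obtain g :: "nat \<Rightarrow> nat" where g: "strict_mono g"
      "\<forall>a\<in>J. \<forall>i j. i \<le> j \<longrightarrow> count (f (g i)) a \<le> count (f (g j)) a" 
      by (elim exE conjE) (rule that)
    define c where "c = (\<lambda>i. count (f (g i)) a)"
    obtain h where h: "strict_mono h" "monoseq (\<lambda>i. c (h i))"
      using seq_monosub[of c] by blast
    obtain m where m: "\<And>i. c (h m) \<le> c (h i)"
      using ex_has_least_nat[of "\<lambda>_. True" 0 "\<lambda>i. c (h i)"] by auto
    have mono: "c (h (m + i)) \<le> c (h (m + j))" if "i \<le> j" for i j
    proof (cases "incseq (\<lambda>i. c (h i))")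
      case True
      then show ?thesis using that by (auto simp: incseq_def)
    next
      case False
      then have "decseq (\<lambda>i. c (h i))"
        using h(2) by (auto simp: monoseq_iff)
      then have "c (h (m + i)) \<le> c (h m)"
        by (auto simp: decseq_def)
      then show ?thesis using m[of "m + j"] by linarith
    qed
    have sm: "strict_mono (\<lambda>i. h (m + i))"
      using h(1) by (auto simp: strict_mono_def)
    have "strict_mono (\<lambda>i. g (h (m + i)))"
      using g(1) sm by (auto simp: strict_mono_def)
    moreover have "count (f (g (h (m + i)))) b \<le> count (f (g (h (m + j)))) b"
      if "b \<in> insert a J" "i \<le> j" for b i j
    proof (cases "b = a")
      case True
      then show ?thesis using mono[OF that(2)] by (simp add: c_def)
    next
      case False
      moreover have "h (m + i) \<le> h (m + j)"
        using strict_mono_leD[OF sm that(2)] .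
      ultimately show ?thesis using g(2) that(1) by blast
    qed
    ultimately show ?case by (intro exI[of _ "\<lambda>i. g (h (m + i))"]) blast
  qed
  then obtain g :: "nat \<Rightarrow> nat" where g: "strict_mono g"
    "\<forall>a\<in>I. \<forall>i j. i \<le> j \<longrightarrow> count (f (g i)) a \<le> count (f (g j)) a" 
    by (elim exE conjE) (rule that)
  have mono: "f (g i) \<subseteq># f (g j)" if "i \<le> j" for i j
  proof (rule mset_subset_eqI)
    fix a
    show "count (f (g i)) a \<le> count (f (g j)) a"
    proof (cases "a \<in> I")
      case True
      then show ?thesis using g(2) that by blast
    next
      case False
      then have "a \<notin># f (g i)" using assms(2) by blast
      then show ?thesis by (simp add: not_in_iff)
    qed
  qed
  show ?thesis by (intro exI[of _ g] conjI allI impI g(1) mono)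
qed

text \<open>
  The minimal elements of \<open>S\<close> are finite in number, so their sizes are bounded. The bound alone is
  obtained without counting them: if it failed, choose for each \<open>D\<close> a pair in \<open>S\<close> above no pair of
  size at most \<open>D\<close>. In a monotone subsequence the first pair lies below all later ones, and it
  contradicts the choice of the pair belonging to a sufficiently large \<open>D\<close>.
\<close>

lemma bounded_minorants:
  fixes S :: "('a multiset \<times> 'a multiset) set"
  assumes "finite I" and "\<And>U V. (U, V) \<in> S \<Longrightarrow> set_mset U \<subseteq> I \<and> set_mset V \<subseteq> I"
  shows "\<exists>D. \<forall>U V. (U, V) \<in> S \<longrightarrow>
    (\<exists>(m, m') \<in> S. m \<subseteq># U \<and> m' \<subseteq># V \<and> size m \<le> D \<and> size m' \<le> D)"
proof (rule ccontr)
  assume "\<not> ?thesis"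
  then have "\<forall>D. \<exists>p. p \<in> S \<and> \<not> (\<exists>(m, m') \<in> S. m \<subseteq># fst p \<and> m' \<subseteq># snd p \<and> size m \<le> D \<and> size m' \<le> D)"
    by (simp add: split_paired_Ex)
  then obtain p where p: "\<And>D. p D \<in> S"
    and bad: "\<And>D m m'. (m, m') \<in> S \<Longrightarrow> m \<subseteq># fst (p D) \<Longrightarrow> m' \<subseteq># snd (p D) \<Longrightarrow>
       size m \<le> D \<Longrightarrow> size m' \<le> D \<Longrightarrow> False"
    unfolding choice_iff by blast
  have sup: "set_mset (fst (p i)) \<subseteq> I" "set_mset (snd (p i)) \<subseteq> I" for i
    using assms(2)[of "fst (p i)" "snd (p i)"] p[of i] by auto
  obtain g :: "nat \<Rightarrow> nat" where g: "strict_mono g" "\<And>i j. i \<le> j \<Longrightarrow> fst (p (g i)) \<subseteq># fst (p (g j))"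
    using monotone_subsequence_of_multisets[OF assms(1), of "\<lambda>i. fst (p i)"] sup by auto
  obtain h :: "nat \<Rightarrow> nat" where h: "strict_mono h" "\<And>i j. i \<le> j \<Longrightarrow> snd (p (g (h i))) \<subseteq># snd (p (g (h j)))"
    using monotone_subsequence_of_multisets[OF assms(1), of "\<lambda>i. snd (p (g i))"] sup by auto
  define D where "D = size (fst (p (g (h 0)))) + size (snd (p (g (h 0))))"
  have "D \<le> h D" "h D \<le> g (h D)"
    using seq_suble[OF h(1)] seq_suble[OF g(1)] by auto
  then have "D \<le> g (h D)" by linarith
  show False
  proof (rule bad[of "fst (p (g (h 0)))" "snd (p (g (h 0)))" "g (h D)"])
    show "(fst (p (g (h 0))), snd (p (g (h 0)))) \<in> S" using p by simp
    show "fst (p (g (h 0))) \<subseteq># fst (p (g (h D)))"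
      by (rule g(2)) (simp add: strict_mono_leD[OF h(1)])
    show "snd (p (g (h 0))) \<subseteq># snd (p (g (h D)))"
      by (rule h(2)) simp
    show "size (fst (p (g (h 0)))) \<le> g (h D)" "size (snd (p (g (h 0)))) \<le> g (h D)"
      using \<open>D \<le> g (h D)\<close> unfolding D_def by linarith+
  qed
qed

section \<open>Tables and steps between them\<close>

text \<open>
  A point of a fiber of the \<open>r\<close>-fold fiber power is a multiset \<open>X\<close> of \<open>r\<close>-tuples, called a table
  below; a tuple is one of its rows, and its entries at position \<open>k\<close> form a column.
\<close>

definition column :: "nat \<Rightarrow> 'i list multiset \<Rightarrow> 'i multiset" where
  "column k X = {#l ! k. l \<in># X#}"

lemma column_simps [simp]:
  "column k {#} = {#}"
  "column k (add_mset l X) = add_mset (l ! k) (column k X)"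
  "column k (X + Y) = column k X + column k Y"
  by (simp_all add: column_def)

lemma size_column [simp]: "size (column k X) = size X"
  by (simp add: column_def)

definition shift :: "('i \<Rightarrow> 'c) \<Rightarrow> 'i multiset \<Rightarrow> 'i multiset \<Rightarrow> 'c \<Rightarrow> int" where
  "shift \<phi> U V = (\<lambda>j. int (count (image_mset \<phi> V) j) - int (count (image_mset \<phi> U) j))"

lemma shift_eq_0_iff: "shift \<phi> U V = (\<lambda>_. 0) \<longleftrightarrow> image_mset \<phi> U = image_mset \<phi> V"
  by (auto simp: shift_def multiset_eq_iff fun_eq_iff)

text \<open>
  The weight of a multiset of indices stands for the matrix-vector product \<open>\<B>v\<close>. The argument
  uses its additivity and cancellation, so \<open>wt\<close> takes values in any cancellative monoid.
\<close>

locale graded_weights =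
  fixes I :: "'i set" and \<phi> :: "'i \<Rightarrow> 'c" and wt :: "'i \<Rightarrow> 'b :: cancel_comm_monoid_add"
  assumes finite_I: "finite I"
begin

abbreviation weight :: "'i multiset \<Rightarrow> 'b" where
  "weight U \<equiv> (\<Sum>i\<in>#U. wt i)"

definition tuples :: "nat \<Rightarrow> 'i list set" where
  "tuples r = {l. length l = r \<and> set l \<subseteq> I \<and> (\<forall>i\<in>set l. \<forall>j\<in>set l. \<phi> i = \<phi> j)}"

lemma class_of_entry: "l \<in> tuples r \<Longrightarrow> j < r \<Longrightarrow> k < r \<Longrightarrow> \<phi> (l ! j) = \<phi> (l ! k)"
  by (auto simp: tuples_def)

lemma list_update_in_tuples:
  assumes "l \<in> tuples r" "v \<in> I" "j < r" "\<phi> v = \<phi> (l ! j)"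
  shows "l[k := v] \<in> tuples r"
proof -
  have l: "length l = r" "set l \<subseteq> I" "\<forall>i\<in>set l. \<forall>i'\<in>set l. \<phi> i = \<phi> i'"
    using assms(1) unfolding tuples_def by blast+
  have "l ! j \<in> set l" using assms(3) l(1) by simp
  with l(3) have all: "\<phi> i = \<phi> v" if "i \<in> insert v (set l)" for i
    using assms(4) that by (metis insertE)
  have sub: "set (l[k := v]) \<subseteq> insert v (set l)" by (rule set_update_subset_insert)
  show ?thesis
    unfolding tuples_def
  proof (intro CollectI conjI ballI)
    show "length (l[k := v]) = r" using l(1) by simp
    show "set (l[k := v]) \<subseteq> I" using sub l(2) assms(2) by blast
    show "\<phi> i = \<phi> i'" if "i \<in> set (l[k := v])" "i' \<in> set (l[k := v])" for i i'
      using all[of i] all[of i'] sub that by (metis subsetD)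
  qed
qed

lemma set_column:
  assumes "set_mset X \<subseteq> tuples r" "k < r"
  shows "set_mset (column k X) \<subseteq> I"
  using assms by (auto simp: column_def tuples_def subset_iff)

lemma classes_column:
  assumes "set_mset X \<subseteq> tuples r" "k < r"
  shows "image_mset \<phi> (column k X) = image_mset \<phi> (column 0 X)"
proof -
  have "\<phi> (l ! k) = \<phi> (l ! 0)" if "l \<in># X" for l
    using assms that class_of_entry[of l r k 0] by auto
  then show ?thesis by (auto simp: column_def multiset.map_comp intro!: image_mset_cong)
qed

text \<open>
  A step replaces at most \<open>D\<close> rows by at most \<open>D\<close> other rows and keeps the weight of every column,
  so it is a move of degree at most \<open>D\<close> inside a fiber of the fiber power.
\<close>

definition steps :: "nat \<Rightarrow> nat \<Rightarrow> ('i list multiset \<times> 'i list multiset) set" where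
  "steps r D = {(X, Y). set_mset X \<subseteq> tuples r \<and> set_mset Y \<subseteq> tuples r \<and>
     (\<forall>k<r. weight (column k X) = weight (column k Y)) \<and>
     (\<exists>P Q R. X = P + R \<and> Y = Q + R \<and> size P \<le> D \<and> size Q \<le> D)}"

lemma stepsI:
  assumes "set_mset (P + R) \<subseteq> tuples r" "set_mset (Q + R) \<subseteq> tuples r"
    and "\<And>k. k < r \<Longrightarrow> weight (column k (P + R)) = weight (column k (Q + R))"
    and "size P \<le> D" "size Q \<le> D"
  shows "(P + R, Q + R) \<in> steps r D"
  using assms unfolding steps_def by blast

lemma steps_mono: "D \<le> D' \<Longrightarrow> steps r D \<subseteq> steps r D'"
  unfolding steps_def using order_trans[of _ D D'] by fast

lemma steps_rtrancl_mono: "(X, Y) \<in> (steps r D)\<^sup>* \<Longrightarrow> D \<le> D' \<Longrightarrow> (X, Y) \<in> (steps r D')\<^sup>*"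
  using rtrancl_mono[OF steps_mono] by blast

lemma steps_rtrancl_add:
  assumes "(X, Y) \<in> (steps r D)\<^sup>*" and "set_mset Z \<subseteq> tuples r"
  shows "(X + Z, Y + Z) \<in> (steps r D)\<^sup>*"
  using assms(1)
proof (induction rule: rtrancl_induct)
  case (step Y Y')
  obtain P Q R where "Y = P + R" "Y' = Q + R" "size P \<le> D" "size Q \<le> D"
    using step(2) by (auto simp: steps_def)
  then have "(P + (R + Z), Q + (R + Z)) \<in> steps r D"
    using step(2) assms(2) by (intro stepsI) (auto simp: steps_def)
  then have "(Y + Z, Y' + Z) \<in> steps r D"
    using \<open>Y = P + R\<close> \<open>Y' = Q + R\<close> by (simp add: ac_simps)
  with step(3) show ?case by (rule rtrancl_into_rtrancl)
qed simp

lemma steps_rtrancl_weight: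
  assumes "(X, Y) \<in> (steps r D)\<^sup>*" "k < r"
  shows "weight (column k X) = weight (column k Y)"
  using assms by (induction rule: rtrancl_induct) (auto simp: steps_def)

lemma steps_rtrancl_tuples:
  assumes "(X, Y) \<in> (steps r D)\<^sup>*" "set_mset X \<subseteq> tuples r"
  shows "set_mset Y \<subseteq> tuples r"
  using assms by (induction rule: rtrancl_induct) (auto simp: steps_def)

section \<open>Tables with equal columns\<close>

text \<open>
  The table is rearranged until it contains \<open>y\<close>, by making some row \<open>x\<close> agree with \<open>y\<close> on longer and
  longer prefixes. The entry \<open>y ! k\<close> occurs in column \<open>k\<close> of some row \<open>z\<close>; as \<open>x\<close> starts with \<open>y ! 0\<close>,
  the rows \<open>x\<close>, \<open>y\<close> and \<open>z\<close> belong to the same \<open>\<phi>\<close>-class, and so \<open>x\<close> and \<open>z\<close> may exchange their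
  entries at position \<open>k\<close>.
\<close>

lemma bring_tuple:
  assumes "r > 0" and X: "set_mset X \<subseteq> tuples r" and y: "y \<in> tuples r"
    and in_columns: "\<And>k. k < r \<Longrightarrow> y ! k \<in># column k X"
  shows "\<exists>X'. (X, add_mset y X') \<in> (steps r 2)\<^sup>* \<and> (\<forall>k<r. column k (add_mset y X') = column k X)"
proof -
  have "\<exists>x X'. (X, add_mset x X') \<in> (steps r 2)\<^sup>* \<and> (\<forall>k<r. column k (add_mset x X') = column k X) \<and>
     x ! 0 = y ! 0 \<and> (\<forall>j<k. x ! j = y ! j)" if "k \<le> r" for k
    using that
  proof (induction k)
    case 0
    \<comment> \<open>Agreement at position 0 is part of the invariant from the start: it fixes the class of \<open>x\<close>.\<close>
    obtain x where x: "x \<in># X" "x ! 0 = y ! 0"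
      using in_columns[OF \<open>r > 0\<close>] by (auto simp: column_def)
    then obtain X' where "X = add_mset x X'" by (metis mset_add)
    then show ?case using x by auto
  next
    case (Suc k)
    then have "k < r" by simp
    from Suc obtain x X' where reach: "(X, add_mset x X') \<in> (steps r 2)\<^sup>*"
      and cols: "\<And>j. j < r \<Longrightarrow> column j (add_mset x X') = column j X"
      and x: "x ! 0 = y ! 0" "\<And>j. j < k \<Longrightarrow> x ! j = y ! j" by auto
    show ?case
    proof (cases "x ! k = y ! k")
      case True
      then have "\<forall>j<Suc k. x ! j = y ! j" using x(2) by (auto simp: less_Suc_eq)
      then show ?thesis using reach cols x by blast
    next
      case False
      then have "k > 0" using x(1) by (cases k) auto
      have "y ! k \<in># column k X'"
        using in_columns[OF \<open>k < r\<close>] False unfolding cols[OF \<open>k < r\<close>, symmetric] by simp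
      then obtain z where z: "z \<in># X'" "z ! k = y ! k" by (auto simp: column_def)
      then obtain R where R: "X' = add_mset z R" by (metis mset_add)
      \<comment> \<open>Exchanging entries \<open>k\<close> leaves all columns unchanged and replaces two rows by two.\<close>
      define x' z' where "x' = x[k := z ! k]" and "z' = z[k := x ! k]"
      have "set_mset (add_mset x X') \<subseteq> tuples r"
        using steps_rtrancl_tuples[OF reach X] .
      then have xr: "x \<in> tuples r" and zr: "z \<in> tuples r" and Rr: "set_mset R \<subseteq> tuples r"
        by (auto simp: R)
      have len: "length x = r" "length z = r" using xr zr by (auto simp: tuples_def)
      have in_I: "x ! k \<in> I" "z ! k \<in> I"
        using xr zr len \<open>k < r\<close> by (auto simp: tuples_def)
      have same_class: "\<phi> (x ! k) = \<phi> (z ! k)"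
        using class_of_entry[OF xr \<open>k < r\<close> \<open>r > 0\<close>] class_of_entry[OF y \<open>k < r\<close> \<open>r > 0\<close>] x(1) z(2)
        by simp
      have x'r: "x' \<in> tuples r"
        unfolding x'_def using list_update_in_tuples[OF xr in_I(2) \<open>k < r\<close>] same_class by simp
      have z'r: "z' \<in> tuples r"
        unfolding z'_def using list_update_in_tuples[OF zr in_I(1) \<open>k < r\<close>] same_class by simp
      have swapped: "column j (add_mset x' (add_mset z' R)) = column j (add_mset x X')" if "j < r" for j
        using that len by (cases "j = k") (auto simp: x'_def z'_def R add_mset_commute)
      have "(add_mset x X', add_mset x' (add_mset z' R)) \<in> steps r 2"
      proof -
        have "({#x, z#} + R, {#x', z'#} + R) \<in> steps r 2"
        proof (rule stepsI)
          fix j assume "j < r"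
          show "weight (column j ({#x, z#} + R)) = weight (column j ({#x', z'#} + R))"
            using arg_cong[OF swapped[OF \<open>j < r\<close>], of "\<lambda>U. weight U"] by (simp add: R ac_simps)
        qed (use xr zr x'r z'r Rr in auto)
        then show ?thesis by (simp add: R)
      qed
      with reach have "(X, add_mset x' (add_mset z' R)) \<in> (steps r 2)\<^sup>*"
        by (rule rtrancl_into_rtrancl)
      moreover have "\<forall>j<r. column j (add_mset x' (add_mset z' R)) = column j X"
        using swapped cols by metis
      moreover have "x' ! 0 = y ! 0" "\<forall>j<Suc k. x' ! j = y ! j"
        using x z(2) \<open>k > 0\<close> \<open>k < r\<close> len by (auto simp: x'_def nth_list_update less_Suc_eq)
      ultimately show ?thesis by blast
    qed
  qed
  from this[OF order_refl] obtain x X' where reach: "(X, add_mset x X') \<in> (steps r 2)\<^sup>*"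
    and cols: "\<forall>j<r. column j (add_mset x X') = column j X"
    and x: "\<forall>j<r. x ! j = y ! j" by blast
  have "x \<in> tuples r"
    using steps_rtrancl_tuples[OF reach X] by simp
  then have "x = y" using x y by (auto simp: tuples_def intro!: nth_equalityI)
  then show ?thesis using reach cols by blast
qed

text \<open>
  Induction on \<open>Y\<close>: produce one row of \<open>Y\<close> in \<open>X\<close> by exchanges, then remove it from both tables.
  These are the quadratic moves between contingency tables with the same margins.
\<close>

lemma equal_columns_connected:
  assumes "r > 0" and "set_mset X \<subseteq> tuples r" and "set_mset Y \<subseteq> tuples r"
    and "\<And>k. k < r \<Longrightarrow> column k X = column k Y"
  shows "(X, Y) \<in> (steps r 2)\<^sup>*"
  using assms(2-)
proof (induction Y arbitrary: X)
  case empty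
  then have "size X = 0" using assms(1) by (metis size_column size_empty column_simps(1))
  then show ?case by simp
next
  case (add y Y)
  have "y ! k \<in># column k X" if "k < r" for k
    using add.prems(3)[OF that] by simp
  moreover have "y \<in> tuples r" using add.prems(2) by simp
  ultimately have "\<exists>X'. (X, add_mset y X') \<in> (steps r 2)\<^sup>* \<and> (\<forall>k<r. column k (add_mset y X') = column k X)"
    by (intro bring_tuple[OF assms(1) add.prems(1)])
  then obtain X' where
    X': "(X, add_mset y X') \<in> (steps r 2)\<^sup>*" "\<And>k. k < r \<Longrightarrow> column k (add_mset y X') = column k X"
    by blast
  have rX': "set_mset X' \<subseteq> tuples r"
    using steps_rtrancl_tuples[OF X'(1) add.prems(1)] by simp
  have "column k X' = column k Y" if "k < r" for k
    using X'(2)[OF that] add.prems(3)[OF that] by simp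
  then have "(X', Y) \<in> (steps r 2)\<^sup>*"
    using add.IH[OF rX'] add.prems(2) by simp
  then have "(X' + {#y#}, Y + {#y#}) \<in> (steps r 2)\<^sup>*"
    using add.prems(2) by (intro steps_rtrancl_add) auto
  with X'(1) show ?case by simp
qed

section \<open>Replacing parts of all columns simultaneously\<close>

text \<open>
  Columns fit together into a table as soon as they have the same number of entries in each class:
  repeatedly pick an entry of one class from each column to form a row.
\<close>

lemma table_with_columns:
  assumes "r > 0" and "\<And>k. k < r \<Longrightarrow> set_mset (M k) \<subseteq> I"
    and "\<And>k. k < r \<Longrightarrow> image_mset \<phi> (M k) = c"
  shows "\<exists>P. set_mset P \<subseteq> tuples r \<and> (\<forall>k<r. column k P = M k)"
  using assms(2-)
proof (induction c arbitrary: M)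
  case empty
  then show ?case by (intro exI[of _ "{#}"]) auto
next
  case (add j c)
  have "\<exists>i. i \<in># M k \<and> \<phi> i = j" if "k < r" for k
  proof -
    have "j \<in># image_mset \<phi> (M k)" using add.prems(2)[OF that] by simp
    then show ?thesis by auto
  qed
  then obtain i where i: "\<And>k. k < r \<Longrightarrow> i k \<in># M k" "\<And>k. k < r \<Longrightarrow> \<phi> (i k) = j"
    by metis
  define M' where "M' k = M k - {#i k#}" for k
  have M: "M k = add_mset (i k) (M' k)" if "k < r" for k
    using i(1)[OF that] by (simp add: M'_def)
  obtain P where P: "set_mset P \<subseteq> tuples r" "\<forall>k<r. column k P = M' k"
  proof (atomize_elim, rule add.IH)
    fix k assume k: "k < r"
    show "set_mset (M' k) \<subseteq> I" using add.prems(1)[OF k] by (auto simp: M[OF k])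
    show "image_mset \<phi> (M' k) = c" using add.prems(2)[OF k] i(2)[OF k] by (simp add: M[OF k])
  qed
  define l where "l = map i [0..<r]"
  have "l \<in> tuples r"
    using i add.prems(1) by (auto simp: l_def tuples_def subset_iff)
  then show ?case
    using P M by (intro exI[of _ "add_mset l P"]) (auto simp: l_def)
qed

text \<open>
  The bound for replacing parts of size at most \<open>D\<close> in all columns at once: \<open>D * card (\<phi> ` I)\<close> rows
  contain the parts to be replaced, at most \<open>D\<close> further rows may be created, and 2 is the degree of
  an exchange. It is independent of the number \<open>r\<close> of columns.
\<close>

definition step_bound :: "nat \<Rightarrow> nat" where
  "step_bound D = 2 + D + D * card (\<phi> ` I)"

text \<open>
  The parts \<open>m k\<close> may consist of different classes for different \<open>k\<close>, so they need not be the columns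
  of a table. Each is enlarged, within its own column of \<open>X\<close>, to a part \<open>m k + p k\<close> whose multiset of
  classes is a common \<open>c\<close>. After exchanges these parts are the columns of a table \<open>P\<close> contained in the
  rearranged \<open>X\<close>. Since every replacement shifts the classes by the same amount \<open>g\<close>, the multisets
  \<open>m' k + p k\<close> again have common classes and form a table \<open>Q\<close>, and the step from \<open>P\<close> to \<open>Q\<close> does all
  replacements at once.
\<close>

lemma replace_in_all_columns:
  assumes "r > 0" and X: "set_mset X \<subseteq> tuples r"
    and sub: "\<And>k. k < r \<Longrightarrow> m k \<subseteq># column k X"
    and m': "\<And>k. k < r \<Longrightarrow> set_mset (m' k) \<subseteq> I"
    and wts: "\<And>k. k < r \<Longrightarrow> weight (m k) = weight (m' k)"
    and shift: "\<And>k. k < r \<Longrightarrow> shift \<phi> (m k) (m' k) = g"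
    and size: "\<And>k. k < r \<Longrightarrow> size (m k) \<le> D" "\<And>k. k < r \<Longrightarrow> size (m' k) \<le> D"
  shows "\<exists>Y. (X, Y) \<in> (steps r (step_bound D))\<^sup>* \<and>
    (\<forall>k<r. column k Y = column k X - m k + m' k)"
proof -
  define W where "W = image_mset \<phi> (column 0 X)"
  have W: "image_mset \<phi> (column k X) = W" if "k < r" for k
    using classes_column[OF X that] by (simp add: W_def)
  \<comment> \<open>Truncating the multiplicities of \<open>W\<close> at \<open>D\<close> gives a multiset that lies between the classes of
    every \<open>m k\<close> and those of the columns of \<open>X\<close>, and whose size is bounded independently of \<open>X\<close>.\<close>
  define c where "c = W \<inter># repeat_mset D (mset_set (\<phi> ` I))"
  have count_c: "count c j = min (count W j) D" for j
  proof (cases "j \<in> \<phi> ` I")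
    case True
    then show ?thesis using finite_I by (simp add: c_def)
  next
    case False
    have "set_mset W \<subseteq> \<phi> ` I" using set_column[OF X \<open>r > 0\<close>] by (auto simp: W_def)
    with False have "count W j = 0" by (auto simp: not_in_iff[symmetric])
    then show ?thesis by (simp add: c_def)
  qed
  have size_c: "size c \<le> D * card (\<phi> ` I)"
  proof -
    have "size c \<le> size (repeat_mset D (mset_set (\<phi> ` I)))"
      unfolding c_def by (intro size_mset_mono) simp
    then show ?thesis using finite_I by simp
  qed
  have "\<exists>p. p \<subseteq># column k X - m k \<and> image_mset \<phi> p = c - image_mset \<phi> (m k)" if k: "k < r" for k
  proof -
    have "image_mset \<phi> (column k X - m k) = W - image_mset \<phi> (m k)"
      using image_mset_Diff[OF sub[OF k], of \<phi>] W[OF k] by simp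
    moreover have "c - image_mset \<phi> (m k) \<subseteq># W - image_mset \<phi> (m k)"
      by (intro mset_subset_eqI) (simp add: count_c)
    ultimately obtain e where "image_mset \<phi> (column k X - m k) = (c - image_mset \<phi> (m k)) + e"
      by (metis subset_mset.less_eqE)
    from image_mset_eq_plusD[OF this] obtain p q where
      "column k X - m k = p + q" "c - image_mset \<phi> (m k) = image_mset \<phi> p" by blast
    then show ?thesis by (intro exI[of _ p]) simp
  qed
  then obtain p where p: "\<And>k. k < r \<Longrightarrow> p k \<subseteq># column k X - m k"
    "\<And>k. k < r \<Longrightarrow> image_mset \<phi> (p k) = c - image_mset \<phi> (m k)" by metis
  have mc: "count (image_mset \<phi> (m k)) j \<le> count c j" if k: "k < r" for k j
  proof -
    have "count (image_mset \<phi> (m k)) j \<le> count W j"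
      using mset_subset_eq_count[OF image_mset_subseteq_mono[OF sub[OF k], of \<phi>]] W[OF k] by simp
    moreover have "count (image_mset \<phi> (m k)) j \<le> size (image_mset \<phi> (m k))"
      by (rule count_le_size)
    ultimately show ?thesis using size(1)[OF k] by (simp add: count_c)
  qed
  have classes_old: "image_mset \<phi> (m k + p k) = c" if "k < r" for k
    using mc[OF that] p(2)[OF that] by (auto simp: multiset_eq_iff)
  define c' where "c' = image_mset \<phi> (m' 0 + p 0)"
  have count_c': "int (count (image_mset \<phi> (m' k + p k)) j) = int (count c j) + g j" if "k < r" for k j
    using mc[OF that, of j] p(2)[OF that] shift[OF that] by (auto simp: shift_def fun_eq_iff)
  have classes_new: "image_mset \<phi> (m' k + p k) = c'" if "k < r" for k
    unfolding c'_def using count_c'[OF that] count_c'[OF \<open>r > 0\<close>]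
    by (intro multiset_eqI) (metis of_nat_eq_iff)
  have split: "column k X = (m k + p k) + (column k X - (m k + p k))" if "k < r" for k
    using sub[OF that] p(1)[OF that]
    by (metis subset_mset.add_diff_inverse subset_mset.le_diff_conv2 add.commute)
  have supp: "set_mset (m k + p k) \<subseteq> I" "set_mset (column k X - (m k + p k)) \<subseteq> I" if k: "k < r" for k
  proof -
    have "set_mset (column k X) = set_mset (m k + p k) \<union> set_mset (column k X - (m k + p k))"
      by (subst split[OF k]) (simp only: set_mset_union)
    then show "set_mset (m k + p k) \<subseteq> I" "set_mset (column k X - (m k + p k)) \<subseteq> I"
      using set_column[OF X k] by blast+
  qed
  obtain P where P: "set_mset P \<subseteq> tuples r" "\<And>k. k < r \<Longrightarrow> column k P = m k + p k"
    using table_with_columns[OF \<open>r > 0\<close>, of "\<lambda>k. m k + p k" c] supp(1) classes_old by auto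
  obtain Q where Q: "set_mset Q \<subseteq> tuples r" "\<And>k. k < r \<Longrightarrow> column k Q = m' k + p k"
  proof (atomize_elim)
    have "set_mset (m' k + p k) \<subseteq> I" if "k < r" for k
      using supp(1)[OF that] m'[OF that] by auto
    then show "\<exists>Q. set_mset Q \<subseteq> tuples r \<and> (\<forall>k. k < r \<longrightarrow> column k Q = m' k + p k)"
      using table_with_columns[OF \<open>r > 0\<close>, of "\<lambda>k. m' k + p k" c'] classes_new by blast
  qed
  obtain R where R: "set_mset R \<subseteq> tuples r" "\<And>k. k < r \<Longrightarrow> column k R = column k X - (m k + p k)"
  proof (atomize_elim)
    have "image_mset \<phi> (column k X - (m k + p k)) = W - c" if "k < r" for k
      using image_mset_Diff[of "m k + p k" "column k X" \<phi>] split[OF that] W[OF that] classes_old[OF that]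
      by (metis mset_subset_eq_add_left)
    then show "\<exists>R. set_mset R \<subseteq> tuples r \<and> (\<forall>k. k < r \<longrightarrow> column k R = column k X - (m k + p k))"
      using table_with_columns[OF \<open>r > 0\<close>, of "\<lambda>k. column k X - (m k + p k)" "W - c"] supp(2) by blast
  qed
  have "(X, P + R) \<in> (steps r 2)\<^sup>*"
    using X P R split by (intro equal_columns_connected[OF \<open>r > 0\<close>]) auto
  then have "(X, P + R) \<in> (steps r (step_bound D))\<^sup>*"
    by (rule steps_rtrancl_mono) (simp add: step_bound_def)
  moreover have "(P + R, Q + R) \<in> steps r (step_bound D)"
  proof -
    have "size P = size c"
      using P(2)[OF \<open>r > 0\<close>] classes_old[OF \<open>r > 0\<close>] by (metis size_column size_image_mset)
    moreover have "size Q = size (m' 0) + size (p 0)"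
      using Q(2)[OF \<open>r > 0\<close>] by (metis size_column size_union)
    moreover have "size (p 0) \<le> size c"
      using p(2)[OF \<open>r > 0\<close>] by (metis size_image_mset diff_subset_eq_self size_mset_mono)
    ultimately have "size P \<le> step_bound D" "size Q \<le> step_bound D"
      using size(2)[OF \<open>r > 0\<close>] size_c by (auto simp: step_bound_def)
    moreover have "\<forall>k<r. weight (column k (P + R)) = weight (column k (Q + R))"
      using P(2) Q(2) wts by simp
    ultimately show ?thesis using P(1) Q(1) R(1) by (intro stepsI) auto
  qed
  ultimately have "(X, Q + R) \<in> (steps r (step_bound D))\<^sup>*" by (rule rtrancl_into_rtrancl)
  moreover have "column k (Q + R) = column k X - m k + m' k" if k: "k < r" for k
  proof -
    have "column k X - m k = p k + (column k X - (m k + p k))"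
      by (subst split[OF k]) (simp add: ac_simps)
    then show ?thesis using Q(2)[OF k] R(2)[OF k] by (simp add: ac_simps)
  qed
  ultimately show ?thesis by blast
qed

section \<open>Connecting tables within a fiber\<close>

text \<open>
  If the class multiset of a column \<open>U\<close> can be shifted by \<open>g\<close> within the fiber at all, as \<open>V\<close> shows,
  then replacing a part of bounded size does it: a pair \<open>(m, m')\<close> below \<open>(U, V)\<close> with the same shift
  and equal weights yields the column \<open>U - m + m'\<close>, whose weight and classes are those of \<open>V\<close>
  because weights and shifts are additive.
\<close>

lemma bounded_lift:
  obtains D where "\<And>U V. set_mset U \<subseteq> I \<Longrightarrow> set_mset V \<subseteq> I \<Longrightarrow> weight U = weight V \<Longrightarrow> shift \<phi> U V = g \<Longrightarrow>
    \<exists>m m'. m \<subseteq># U \<and> m' \<subseteq># V \<and> weight m = weight m' \<and> shift \<phi> m m' = g \<and> size m \<le> D \<and> size m' \<le> D"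
proof -
  define S where "S = {(U, V). set_mset U \<subseteq> I \<and> set_mset V \<subseteq> I \<and> weight U = weight V \<and> shift \<phi> U V = g}"
  obtain D where D: "\<forall>U V. (U, V) \<in> S \<longrightarrow>
    (\<exists>(m, m') \<in> S. m \<subseteq># U \<and> m' \<subseteq># V \<and> size m \<le> D \<and> size m' \<le> D)"
    using bounded_minorants[OF finite_I, of S] by (auto simp: S_def)
  show ?thesis
  proof (rule that)
    fix U V
    assume "set_mset U \<subseteq> I" "set_mset V \<subseteq> I" "weight U = weight V" "shift \<phi> U V = g"
    then have "(U, V) \<in> S" by (simp add: S_def)
    with D obtain m m' where "(m, m') \<in> S" "m \<subseteq># U" "m' \<subseteq># V" "size m \<le> D" "size m' \<le> D"
      by blast
    then show "\<exists>m m'. m \<subseteq># U \<and> m' \<subseteq># V \<and> weight m = weight m' \<and> shift \<phi> m m' = g \<and> size m \<le> D \<and> size m' \<le> D"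
      by (auto simp: S_def)
  qed
qed

text \<open>
  The same reasoning without a shift. Minimality has to be taken among nonempty multisets, since the
  empty pair, which makes no progress, lies below everything.
\<close>

lemma bounded_nonempty_part:
  obtains D where "\<And>U V. set_mset U \<subseteq> I \<Longrightarrow> set_mset V \<subseteq> I \<Longrightarrow> weight U = weight V \<Longrightarrow>
    image_mset \<phi> U = image_mset \<phi> V \<Longrightarrow>
    \<exists>m m'. m \<subseteq># U \<and> m' \<subseteq># V \<and> weight m = weight m' \<and> image_mset \<phi> m = image_mset \<phi> m' \<and>
       size m \<le> D \<and> size m' \<le> D \<and> (U \<noteq> {#} \<longrightarrow> m \<noteq> {#})"
proof -
  define S where "S = {(U, V). set_mset U \<subseteq> I \<and> set_mset V \<subseteq> I \<and> weight U = weight V \<and>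
    image_mset \<phi> U = image_mset \<phi> V \<and> U \<noteq> {#}}"
  obtain D where D: "\<forall>U V. (U, V) \<in> S \<longrightarrow>
    (\<exists>(m, m') \<in> S. m \<subseteq># U \<and> m' \<subseteq># V \<and> size m \<le> D \<and> size m' \<le> D)"
    using bounded_minorants[OF finite_I, of S] by (auto simp: S_def)
  show ?thesis
  proof (rule that)
    fix U V
    assume asm: "set_mset U \<subseteq> I" "set_mset V \<subseteq> I" "weight U = weight V" "image_mset \<phi> U = image_mset \<phi> V"
    show "\<exists>m m'. m \<subseteq># U \<and> m' \<subseteq># V \<and> weight m = weight m' \<and> image_mset \<phi> m = image_mset \<phi> m' \<and>
       size m \<le> D \<and> size m' \<le> D \<and> (U \<noteq> {#} \<longrightarrow> m \<noteq> {#})"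
    proof (cases "U = {#}")
      case True
      then show ?thesis by (intro exI[of _ "{#}"]) simp
    next
      case False
      then have "(U, V) \<in> S" using asm by (simp add: S_def)
      with D obtain m m' where "(m, m') \<in> S" "m \<subseteq># U" "m' \<subseteq># V" "size m \<le> D" "size m' \<le> D"
        by blast
      then show ?thesis by (auto simp: S_def)
    qed
  qed
qed

text \<open>
  Move all columns of \<open>X\<close> towards those of \<open>Y\<close> simultaneously. The columns are split into a finished
  part \<open>Z\<close> and an unfinished part \<open>U\<close> that is still to become \<open>V\<close>; each replacement of bounded
  nonempty parts of \<open>U\<close> by parts of \<open>V\<close> shrinks \<open>U\<close>, and the new entries join \<open>Z\<close>. Once all
  columns agree, exchanges finish the path.
\<close>

lemma equal_classes_connected:
  obtains K where "\<And>r X Y. r > 0 \<Longrightarrow> set_mset X \<subseteq> tuples r \<Longrightarrow> set_mset Y \<subseteq> tuples r \<Longrightarrow>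
     \<forall>k<r. weight (column k X) = weight (column k Y) \<Longrightarrow>
     image_mset \<phi> (column 0 X) = image_mset \<phi> (column 0 Y) \<Longrightarrow> (X, Y) \<in> (steps r K)\<^sup>*"
proof -
  obtain D where D: "\<And>U V. set_mset U \<subseteq> I \<Longrightarrow> set_mset V \<subseteq> I \<Longrightarrow> weight U = weight V \<Longrightarrow>
    image_mset \<phi> U = image_mset \<phi> V \<Longrightarrow>
    \<exists>m m'. m \<subseteq># U \<and> m' \<subseteq># V \<and> weight m = weight m' \<and> image_mset \<phi> m = image_mset \<phi> m' \<and>
       size m \<le> D \<and> size m' \<le> D \<and> (U \<noteq> {#} \<longrightarrow> m \<noteq> {#})"
    by (rule bounded_nonempty_part) (rule that)
  have move: "\<exists>Y. (X, Y) \<in> (steps r (step_bound D))\<^sup>* \<and> (\<forall>k<r. column k Y = Z k + V k)"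
    if "r > 0" "set_mset X \<subseteq> tuples r" "\<And>k. k < r \<Longrightarrow> column k X = Z k + U k"
      "\<And>k. k < r \<Longrightarrow> set_mset (U k) \<subseteq> I" "\<And>k. k < r \<Longrightarrow> set_mset (V k) \<subseteq> I"
      "\<And>k. k < r \<Longrightarrow> weight (U k) = weight (V k)"
      "\<And>k. k < r \<Longrightarrow> image_mset \<phi> (U k) = image_mset \<phi> (V k)"
    for r X Z U V
    using that
  proof (induction "\<Sum>k<r. size (U k)" arbitrary: X Z U V rule: less_induct)
    case less
    note prems = less.prems
    show ?case
    proof (cases "\<exists>k<r. U k \<noteq> {#}")
      case False
      then have "V k = {#}" "U k = {#}" if "k < r" for k
        using prems(7)[OF that] that by auto
      then show ?thesis using prems(3) by auto
    next
      case True
      then obtain k0 where k0: "k0 < r" "U k0 \<noteq> {#}" by blast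
      define ok where "ok k m m' \<longleftrightarrow> m \<subseteq># U k \<and> m' \<subseteq># V k \<and> weight m = weight m' \<and>
        image_mset \<phi> m = image_mset \<phi> m' \<and>
        size m \<le> D \<and> size m' \<le> D \<and> (U k \<noteq> {#} \<longrightarrow> m \<noteq> {#})" for k m m'
      have "\<exists>m m'. ok k m m'" if "k < r" for k
        unfolding ok_def using prems(4-7) that by (intro D) auto
      then obtain m m' where "\<And>k. k < r \<Longrightarrow> ok k (m k) (m' k)" by metis
      then have m: "\<And>k. k < r \<Longrightarrow> m k \<subseteq># U k" "\<And>k. k < r \<Longrightarrow> m' k \<subseteq># V k"
        "\<And>k. k < r \<Longrightarrow> weight (m k) = weight (m' k)"
        "\<And>k. k < r \<Longrightarrow> image_mset \<phi> (m k) = image_mset \<phi> (m' k)"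
        "\<And>k. k < r \<Longrightarrow> size (m k) \<le> D" "\<And>k. k < r \<Longrightarrow> size (m' k) \<le> D"
        "\<And>k. k < r \<Longrightarrow> U k \<noteq> {#} \<Longrightarrow> m k \<noteq> {#}" by (simp_all add: ok_def)
      have U: "U k = m k + (U k - m k)" and V: "V k = m' k + (V k - m' k)" if "k < r" for k
        using m(1,2)[OF that] by simp_all
      have "\<exists>Y. (X, Y) \<in> (steps r (step_bound D))\<^sup>* \<and> (\<forall>k<r. column k Y = column k X - m k + m' k)"
      proof (rule replace_in_all_columns[OF prems(1,2), where g = "\<lambda>_. 0"])
        fix k assume k: "k < r"
        show "m k \<subseteq># column k X"
          using prems(3)[OF k] m(1)[OF k] by (simp add: subset_mset.add_increasing)
        show "set_mset (m' k) \<subseteq> I"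
          using prems(5)[OF k] set_mset_mono[OF m(2)[OF k]] by blast
        show "shift \<phi> (m k) (m' k) = (\<lambda>_. 0)"
          using m(4)[OF k] by (simp add: shift_eq_0_iff)
      qed (use m in auto)
      then obtain Y1 where Y1: "(X, Y1) \<in> (steps r (step_bound D))\<^sup>*"
        "\<And>k. k < r \<Longrightarrow> column k Y1 = column k X - m k + m' k" by blast
      have "\<exists>Y. (Y1, Y) \<in> (steps r (step_bound D))\<^sup>* \<and> (\<forall>k<r. column k Y = (Z k + m' k) + (V k - m' k))"
      proof (rule less.hyps[of "\<lambda>k. U k - m k"])
        show "(\<Sum>k<r. size (U k - m k)) < (\<Sum>k<r. size (U k))"
        proof (rule sum_strict_mono_ex1)
          show "\<forall>k\<in>{..<r}. size (U k - m k) \<le> size (U k)" by (auto intro: size_mset_mono)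
          have "size (U k0) = size (m k0) + size (U k0 - m k0)"
            using U[OF k0(1)] by (metis size_union)
          moreover have "size (m k0) > 0" using m(7)[OF k0] by (simp add: nonempty_has_size)
          ultimately show "\<exists>k\<in>{..<r}. size (U k - m k) < size (U k)"
            using k0(1) by (intro bexI[of _ k0]) simp_all
        qed simp
        show "set_mset Y1 \<subseteq> tuples r" by (rule steps_rtrancl_tuples[OF Y1(1) prems(2)])
        fix k assume k: "k < r"
        show "column k Y1 = Z k + m' k + (U k - m k)"
        proof -
          have "column k X - m k = Z k + (U k - m k)"
            using prems(3)[OF k] m(1)[OF k] by (metis subset_mset.add_diff_assoc)
          then show ?thesis using Y1(2)[OF k] by (simp add: ac_simps)
        qed
        show "set_mset (U k - m k) \<subseteq> I" "set_mset (V k - m' k) \<subseteq> I"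
          using prems(4,5)[OF k] by (auto dest: in_diffD)
        have "weight (m k) + weight (U k - m k) = weight (m' k) + weight (V k - m' k)"
          using prems(6)[OF k] U[OF k] V[OF k] by (metis image_mset_union sum_mset.union)
        then show "weight (U k - m k) = weight (V k - m' k)"
          using m(3)[OF k] by simp
        show "image_mset \<phi> (U k - m k) = image_mset \<phi> (V k - m' k)"
          using prems(7)[OF k] m(4)[OF k] by (simp add: image_mset_Diff m(1,2)[OF k])
      qed (rule prems(1))
      then obtain Y where Y: "(Y1, Y) \<in> (steps r (step_bound D))\<^sup>*"
        "\<forall>k<r. column k Y = (Z k + m' k) + (V k - m' k)" by blast
      have "column k Y = Z k + V k" if "k < r" for k
        using Y(2) V[OF that] that by (simp add: ac_simps)
      with rtrancl_trans[OF Y1(1) Y(1)] show ?thesis by blast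
    qed
  qed
  show ?thesis
  proof (rule that)
    fix r :: nat and X Y :: "'i list multiset"
    assume r: "r > 0" and X: "set_mset X \<subseteq> tuples r" and Y: "set_mset Y \<subseteq> tuples r"
      and wts: "\<forall>k<r. weight (column k X) = weight (column k Y)"
      and cls: "image_mset \<phi> (column 0 X) = image_mset \<phi> (column 0 Y)"
    have "\<exists>Y'. (X, Y') \<in> (steps r (step_bound D))\<^sup>* \<and> (\<forall>k<r. column k Y' = {#} + column k Y)"
    proof (rule move[OF r X])
      fix k assume k: "k < r"
      show "column k X = {#} + column k X" by simp
      show "image_mset \<phi> (column k X) = image_mset \<phi> (column k Y)"
        unfolding classes_column[OF X k] classes_column[OF Y k] by (rule cls)
    qed (use set_column[OF X] set_column[OF Y] wts in blast)+
    then obtain Y' where Y': "(X, Y') \<in> (steps r (step_bound D))\<^sup>*" "\<And>k. k < r \<Longrightarrow> column k Y' = column k Y"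
      by auto
    have "(Y', Y) \<in> (steps r 2)\<^sup>*"
      using equal_columns_connected[OF r steps_rtrancl_tuples[OF Y'(1) X] Y] Y'(2) by blast
    then have "(Y', Y) \<in> (steps r (step_bound D))\<^sup>*"
      by (rule steps_rtrancl_mono) (simp add: step_bound_def)
    with Y'(1) show "(X, Y) \<in> (steps r (step_bound D))\<^sup>*" by (rule rtrancl_trans)
  qed
qed

text \<open>
  One edge of the graph on class multisets lifts to a path of bounded steps: the shift \<open>g\<close> is
  performed by a bounded replacement in every column. Finiteness of \<open>\<G>\<close> enters here, as the bounds
  depend on \<open>g\<close>.
\<close>

lemma class_step:
  assumes "finite \<G>"
  obtains K where "\<And>r X V g. r > 0 \<Longrightarrow> set_mset X \<subseteq> tuples r \<Longrightarrow> g \<in> \<G> \<Longrightarrow>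
     \<forall>k<r. set_mset (V k) \<subseteq> I \<and> weight (V k) = weight (column k X) \<and> shift \<phi> (column k X) (V k) = g \<Longrightarrow>
     \<exists>Y. (X, Y) \<in> (steps r K)\<^sup>* \<and> image_mset \<phi> (column 0 Y) = image_mset \<phi> (V 0)"
proof -
  define ok where "ok g D U V m m' \<longleftrightarrow> m \<subseteq># U \<and> m' \<subseteq># V \<and> weight m = weight m' \<and>
    shift \<phi> m m' = g \<and> size m \<le> D \<and> size m' \<le> D" for g D U V m m'
  define liftable where "liftable g U V \<longleftrightarrow>
    set_mset U \<subseteq> I \<and> set_mset V \<subseteq> I \<and> weight U = weight V \<and> shift \<phi> U V = g" for g U V
  have "\<exists>D. \<forall>U V. liftable g U V \<longrightarrow> (\<exists>m m'. ok g D U V m m')" for g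
  proof (rule bounded_lift[of g])
    fix D
    assume D: "\<And>U V. set_mset U \<subseteq> I \<Longrightarrow> set_mset V \<subseteq> I \<Longrightarrow> weight U = weight V \<Longrightarrow> shift \<phi> U V = g \<Longrightarrow>
      \<exists>m m'. m \<subseteq># U \<and> m' \<subseteq># V \<and> weight m = weight m' \<and> shift \<phi> m m' = g \<and> size m \<le> D \<and> size m' \<le> D"
    show ?thesis
      by (rule exI[of _ D]) (use D in \<open>simp add: ok_def liftable_def\<close>)
  qed
  then obtain Dg where Dg: "\<And>g U V. liftable g U V \<Longrightarrow> \<exists>m m'. ok g (Dg g) U V m m'"
    by metis
  define D where "D = (\<Sum>g\<in>\<G>. Dg g)"
  have Dg_le: "Dg g \<le> D" if "g \<in> \<G>" for g
    unfolding D_def using member_le_sum[OF that _ assms, of Dg] by simp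
  show ?thesis
  proof (rule that)
    fix r :: nat and X :: "'i list multiset" and V g
    assume r: "r > 0" and X: "set_mset X \<subseteq> tuples r" and g: "g \<in> \<G>"
      and V: "\<forall>k<r. set_mset (V k) \<subseteq> I \<and> weight (V k) = weight (column k X) \<and> shift \<phi> (column k X) (V k) = g"
    have "\<exists>m m'. ok g (Dg g) (column k X) (V k) m m'" if "k < r" for k
      by (rule Dg) (use set_column[OF X that] V that in \<open>auto simp: liftable_def\<close>)
    then obtain m m' where "\<And>k. k < r \<Longrightarrow> ok g (Dg g) (column k X) (V k) (m k) (m' k)" by metis
    then have m: "\<And>k. k < r \<Longrightarrow> m k \<subseteq># column k X" "\<And>k. k < r \<Longrightarrow> m' k \<subseteq># V k"
      "\<And>k. k < r \<Longrightarrow> weight (m k) = weight (m' k)" "\<And>k. k < r \<Longrightarrow> shift \<phi> (m k) (m' k) = g"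
      "\<And>k. k < r \<Longrightarrow> size (m k) \<le> Dg g" "\<And>k. k < r \<Longrightarrow> size (m' k) \<le> Dg g"
      by (simp_all add: ok_def)
    have "\<exists>Y. (X, Y) \<in> (steps r (step_bound D))\<^sup>* \<and> (\<forall>k<r. column k Y = column k X - m k + m' k)"
    proof (rule replace_in_all_columns[OF r X])
      fix k assume k: "k < r"
      show "set_mset (m' k) \<subseteq> I"
        using V k set_mset_mono[OF m(2)[OF k]] by blast
      show "size (m k) \<le> D" "size (m' k) \<le> D" using m(5,6)[OF k] Dg_le[OF g] by linarith+
    qed (use m in auto)
    then obtain Y where Y: "(X, Y) \<in> (steps r (step_bound D))\<^sup>*" "column 0 Y = column 0 X - m 0 + m' 0"
      using r by blast
    have "image_mset \<phi> (column 0 Y) = image_mset \<phi> (V 0)"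
    proof (rule multiset_eqI)
      fix j
      have "count (image_mset \<phi> (m 0)) j \<le> count (image_mset \<phi> (column 0 X)) j"
        by (intro mset_subset_eq_count image_mset_subseteq_mono m(1) r)
      moreover have "shift \<phi> (column 0 X) (V 0) j = shift \<phi> (m 0) (m' 0) j" using V m(4) r by simp
      ultimately show "count (image_mset \<phi> (column 0 Y)) j = count (image_mset \<phi> (V 0)) j"
        by (simp add: Y(2) shift_def image_mset_Diff[OF m(1)[OF r]])
    qed
    with Y(1) show "\<exists>Y. (X, Y) \<in> (steps r (step_bound D))\<^sup>* \<and> image_mset \<phi> (column 0 Y) = image_mset \<phi> (V 0)"
      by blast
  qed
qed

text \<open>
  The intersection of the projected fibers of the columns of \<open>X\<close>.
\<close>

definition common_classes :: "nat \<Rightarrow> 'i list multiset \<Rightarrow> 'c multiset set" where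
  "common_classes r X = {W. \<forall>k<r. \<exists>U. set_mset U \<subseteq> I \<and> weight U = weight (column k X) \<and> image_mset \<phi> U = W}"

definition class_graph :: "('c \<Rightarrow> int) set \<Rightarrow> 'c multiset set \<Rightarrow> ('c multiset \<times> 'c multiset) set" where
  "class_graph \<G> F = {(W, W'). W \<in> F \<and> W' \<in> F \<and> (\<lambda>j. int (count W' j) - int (count W j)) \<in> \<G>}"

lemma tables_connected:
  assumes "finite \<G>"
  obtains K where "\<And>r X Y. r > 0 \<Longrightarrow> set_mset X \<subseteq> tuples r \<Longrightarrow> set_mset Y \<subseteq> tuples r \<Longrightarrow>
     \<forall>k<r. weight (column k X) = weight (column k Y) \<Longrightarrow>
     (image_mset \<phi> (column 0 X), image_mset \<phi> (column 0 Y)) \<in> (class_graph \<G> (common_classes r X))\<^sup>* \<Longrightarrow>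
     (X, Y) \<in> (steps r K)\<^sup>*"
proof -
  obtain K1 where K1: "\<And>r X V g. r > 0 \<Longrightarrow> set_mset X \<subseteq> tuples r \<Longrightarrow> g \<in> \<G> \<Longrightarrow>
     \<forall>k<r. set_mset (V k) \<subseteq> I \<and> weight (V k) = weight (column k X) \<and> shift \<phi> (column k X) (V k) = g \<Longrightarrow>
     \<exists>Y. (X, Y) \<in> (steps r K1)\<^sup>* \<and> image_mset \<phi> (column 0 Y) = image_mset \<phi> (V 0)"
    by (rule class_step[OF assms]) (rule that)
  obtain K2 where K2: "\<And>r X Y. r > 0 \<Longrightarrow> set_mset X \<subseteq> tuples r \<Longrightarrow> set_mset Y \<subseteq> tuples r \<Longrightarrow>
     \<forall>k<r. weight (column k X) = weight (column k Y) \<Longrightarrow>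
     image_mset \<phi> (column 0 X) = image_mset \<phi> (column 0 Y) \<Longrightarrow> (X, Y) \<in> (steps r K2)\<^sup>*"
    by (rule equal_classes_connected) (rule that)
  show ?thesis
  proof (rule that)
    fix r :: nat and X Y :: "'i list multiset"
    assume r: "r > 0" and X: "set_mset X \<subseteq> tuples r" and Y: "set_mset Y \<subseteq> tuples r"
      and wts: "\<forall>k<r. weight (column k X) = weight (column k Y)"
      and path: "(image_mset \<phi> (column 0 X), image_mset \<phi> (column 0 Y)) \<in> (class_graph \<G> (common_classes r X))\<^sup>*"
    have "\<exists>X'. (X, X') \<in> (steps r K1)\<^sup>* \<and> image_mset \<phi> (column 0 X') = image_mset \<phi> (column 0 Y)"
      using path
    proof (induction rule: rtrancl_induct)
      case base
      then show ?case by blast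
    next
      case (step W W')
      then obtain X' where X': "(X, X') \<in> (steps r K1)\<^sup>*" "image_mset \<phi> (column 0 X') = W" by blast
      note rX' = steps_rtrancl_tuples[OF X'(1) X]
      from step(2) have g: "(\<lambda>j. int (count W' j) - int (count W j)) \<in> \<G>"
        and "W' \<in> common_classes r X" by (auto simp: class_graph_def)
      then obtain V where V: "\<And>k. k < r \<Longrightarrow> set_mset (V k) \<subseteq> I"
        "\<And>k. k < r \<Longrightarrow> weight (V k) = weight (column k X)" "\<And>k. k < r \<Longrightarrow> image_mset \<phi> (V k) = W'"
        unfolding common_classes_def mem_Collect_eq by metis
      have "shift \<phi> (column k X') (V k) = (\<lambda>j. int (count W' j) - int (count W j))" if "k < r" for k
        using V(3)[OF that] classes_column[OF rX' that] X'(2) by (simp add: shift_def)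
      then obtain X'' where X'': "(X', X'') \<in> (steps r K1)\<^sup>*" "image_mset \<phi> (column 0 X'') = image_mset \<phi> (V 0)"
        using K1[OF r rX' g, of V] V(1,2) steps_rtrancl_weight[OF X'(1)] by auto
      from rtrancl_trans[OF X'(1) X''(1)] show ?case using X''(2) V(3)[OF r] by auto
    qed
    then obtain X' where X': "(X, X') \<in> (steps r K1)\<^sup>*"
      "image_mset \<phi> (column 0 X') = image_mset \<phi> (column 0 Y)" by blast
    have "(X', Y) \<in> (steps r K2)\<^sup>*"
      using K2[OF r steps_rtrancl_tuples[OF X'(1) X] Y _ X'(2)] steps_rtrancl_weight[OF X'(1)] wts by auto
    then show "(X, Y) \<in> (steps r (max K1 K2))\<^sup>*"
      using X'(1) by (meson steps_rtrancl_mono rtrancl_trans max.cobounded1 max.cobounded2)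
  qed
qed

end


section \<open>Vectors as multisets of columns\<close>

definition count_vec :: "'a list \<Rightarrow> 'a multiset \<Rightarrow> int vec" where
  "count_vec xs X = vec (length xs) (\<lambda>c. int (count X (xs ! c)))"

lemma count_vec_carrier [simp]: "count_vec xs X \<in> carrier_vec (length xs)"
  "dim_vec (count_vec xs X) = length xs"
  by (simp_all add: count_vec_def)

lemma count_vec_index [simp]: "c < length xs \<Longrightarrow> count_vec xs X $ c = int (count X (xs ! c))"
  by (simp add: count_vec_def)

lemma count_vec_nonneg: "count_vec xs X \<in> nonneg_vecs (length xs)"
  by (auto simp: nonneg_vecs_def less_eq_vec_def)

lemma count_vec_surj:
  assumes "distinct xs" and v: "v \<in> nonneg_vecs (length xs)"
  obtains X where "set_mset X \<subseteq> set xs" "count_vec xs X = v"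
proof -
  define X where "X = (\<Sum>c<length xs. replicate_mset (nat (v $ c)) (xs ! c))"
  have dim: "dim_vec v = length xs" and "0\<^sub>v (length xs) \<le> v"
    using v unfolding nonneg_vecs_def by (blast dest: carrier_vecD)+
  then have pos: "0 \<le> v $ c" if "c < length xs" for c
    unfolding less_eq_vec_def using that by (metis index_zero_vec(1))
  have count: "count X (xs ! c) = nat (v $ c)" if c: "c < length xs" for c
  proof -
    have "count X (xs ! c) = (\<Sum>c'<length xs. if c' = c then nat (v $ c') else 0)"
      unfolding X_def count_sum using assms(1) c
      by (intro sum.cong) (auto simp: nth_eq_iff_index_eq)
    then show ?thesis using c by simp
  qed
  have "count_vec xs X = v"
  proof (rule eq_vecI)
    fix c assume "c < dim_vec v"
    then have "c < length xs" by (simp only: dim)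
    then show "count_vec xs X $ c = v $ c" using pos count by simp
  qed (simp add: dim)
  moreover have "set_mset X \<subseteq> set xs"
    by (auto simp: X_def set_mset_sum split: if_splits)
  ultimately show ?thesis using that by blast
qed

lemma count_vec_inj:
  assumes "set_mset X \<subseteq> set xs" "set_mset Y \<subseteq> set xs" "count_vec xs X = count_vec xs Y"
  shows "X = Y"
proof (rule multiset_eqI)
  fix x
  show "count X x = count Y x"
  proof (cases "x \<in> set xs")
    case True
    then obtain c where "c < length xs" "x = xs ! c" by (auto simp: in_set_conv_nth)
    then show ?thesis using arg_cong[OF assms(3), of "\<lambda>v. v $ c"] by simp
  next
    case False
    then have "x \<notin># X" "x \<notin># Y" using assms(1,2) by blast+
    then show ?thesis by (simp add: not_in_iff)
  qed
qed

lemma sum_counts: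
  fixes h :: "'a \<Rightarrow> int"
  assumes "distinct xs" "set_mset X \<subseteq> set xs"
  shows "(\<Sum>c<length xs. h (xs ! c) * int (count X (xs ! c))) = (\<Sum>l\<in>#X. h l)"
proof -
  have "(\<Sum>c<length xs. h (xs ! c) * int (count X (xs ! c))) = (\<Sum>l\<in>set xs. h l * int (count X l))"
    using bij_betw_nth[OF assms(1) refl refl]
    by (rule sum.reindex_bij_betw[of "(!) xs" _ _ "\<lambda>l. h l * int (count X l)"])
  also have "\<dots> = (\<Sum>l\<in>#X. h l)"
    using assms(2)
  proof (induction X)
    case (add x X)
    have "(\<Sum>l\<in>set xs. h l * int (count (add_mset x X) l)) =
      (\<Sum>l\<in>set xs. h l * int (count X l) + (if l = x then h l else 0))"
      by (intro sum.cong) (auto simp: algebra_simps)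
    also have "\<dots> = (\<Sum>l\<in>set xs. h l * int (count X l)) + h x"
      using add.prems by (simp add: sum.distrib)
    finally show ?case using add by simp
  qed simp
  finally show ?thesis .
qed

lemma mult_count_vec_index:
  assumes "distinct xs" "set_mset X \<subseteq> set xs" "M \<in> carrier_mat m (length xs)" "i < m"
    and "\<And>c. c < length xs \<Longrightarrow> M $$ (i, c) = h (xs ! c)"
  shows "(M *\<^sub>v count_vec xs X) $ i = (\<Sum>l\<in>#X. h l)"
proof -
  have "(M *\<^sub>v count_vec xs X) $ i = (\<Sum>c<length xs. h (xs ! c) * int (count X (xs ! c)))"
    using assms(3-5) by (simp add: scalar_prod_def atLeast0LessThan)
  then show ?thesis using sum_counts[OF assms(1,2)] by simp
qed

lemma vec_deg_count_vec_diff: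
  assumes "distinct xs" "set_mset P \<subseteq> set xs" "set_mset Q \<subseteq> set xs"
  shows "vec_deg (count_vec xs (P + R) - count_vec xs (Q + R)) \<le> max (size P) (size Q)"
proof -
  have size: "(\<Sum>c<length xs. count X (xs ! c)) = size X" if "set_mset X \<subseteq> set xs" for X
  proof -
    have "int (\<Sum>c<length xs. count X (xs ! c)) = int (size X)"
      using sum_counts[OF assms(1) that, of "\<lambda>_. 1"] by simp
    then show ?thesis by linarith
  qed
  let ?v = "count_vec xs (P + R) - count_vec xs (Q + R)"
  have "(\<Sum>c<length xs. nat (?v $ c)) \<le> (\<Sum>c<length xs. count P (xs ! c))"
    by (intro sum_mono) simp
  moreover have "(\<Sum>c<length xs. nat (- ?v $ c)) \<le> (\<Sum>c<length xs. count Q (xs ! c))"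
    by (intro sum_mono) simp
  ultimately show ?thesis using size[OF assms(2)] size[OF assms(3)]
    by (auto simp: vec_deg_def)
qed

text \<open>
  A column of \<open>B\<close> as a function, extended by 0 below the last row: functions form an additive monoid,
  which vectors of unspecified dimension do not.
\<close>

definition col_fun :: "int mat \<Rightarrow> nat \<Rightarrow> nat \<Rightarrow> int" where
  "col_fun B i = (\<lambda>e. if e < dim_row B then B $$ (e, i) else 0)"

lemma sum_mset_fun_apply: "(\<Sum>i\<in>#U. f i) e = (\<Sum>i\<in>#U. f i e :: int)"
  by (induction U) simp_all

lemma mult_count_vec:
  assumes "B \<in> carrier_mat d n" "set_mset U \<subseteq> {..<n}"
  shows "B *\<^sub>v count_vec [0..<n] U = vec d (\<Sum>i\<in>#U. col_fun B i)"
proof (rule eq_vecI)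
  fix e assume "e < dim_vec (vec d (\<Sum>i\<in>#U. col_fun B i))"
  then have e: "e < d" by simp
  have "(B *\<^sub>v count_vec [0..<n] U) $ e = (\<Sum>i\<in>#U. col_fun B i e)"
    using assms e by (intro mult_count_vec_index) (auto simp: col_fun_def)
  then show "(B *\<^sub>v count_vec [0..<n] U) $ e = vec d (\<Sum>i\<in>#U. col_fun B i) $ e"
    using e by (simp add: sum_mset_fun_apply)
qed (use assms in auto)

lemma vec_col_fun_eq_iff:
  assumes "B \<in> carrier_mat d n"
  shows "vec d (\<Sum>i\<in>#U. col_fun B i) = vec d (\<Sum>i\<in>#V. col_fun B i) \<longleftrightarrow>
    (\<Sum>i\<in>#U. col_fun B i) = (\<Sum>i\<in>#V. col_fun B i)"
proof
  assume eq: "vec d (\<Sum>i\<in>#U. col_fun B i) = vec d (\<Sum>i\<in>#V. col_fun B i)"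
  show "(\<Sum>i\<in>#U. col_fun B i) = (\<Sum>i\<in>#V. col_fun B i)"
  proof
    fix e
    show "(\<Sum>i\<in>#U. col_fun B i) e = (\<Sum>i\<in>#V. col_fun B i) e"
    proof (cases "e < d")
      case True
      then show ?thesis using arg_cong[OF eq, of "\<lambda>v. v $ e"] by simp
    next
      case False
      then show ?thesis using assms by (simp add: sum_mset_fun_apply col_fun_def)
    qed
  qed
qed simp

lemma induced_map_count_vec:
  assumes "\<phi> ` {..<n} = {..<t}" "set_mset U \<subseteq> {..<n}"
  shows "induced_map t \<phi> (count_vec [0..<n] U) = count_vec [0..<t] (image_mset \<phi> U)"
proof (rule eq_vecI)
  fix j assume "j < dim_vec (count_vec [0..<t] (image_mset \<phi> U))"
  then have j: "j < t" by simp
  have \<phi>: "\<phi> i < t" if "i < n" for i using assms(1) that by blast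
  have "induced_map t \<phi> (count_vec [0..<n] U) $ j = (\<Sum>i\<in>#U. if \<phi> i = j then 1 else 0)"
    unfolding induced_map_def
    by (rule mult_count_vec_index[where m = t]) (use assms j \<phi> in \<open>auto simp: mat_of_cols_index\<close>)
  also have "\<dots> = int (count (image_mset \<phi> U) j)"
    by (induction U) auto
  finally show "induced_map t \<phi> (count_vec [0..<n] U) $ j = count_vec [0..<t] (image_mset \<phi> U) $ j"
    using j by simp
qed (simp add: induced_map_def)

lemma stacked_cols_dim:
  "dim_vec (stacked_cols B is) = length is * dim_row B"
  by (induction "is") (simp_all add: stacked_cols_def)

lemma stacked_cols_index:
  assumes "set is \<subseteq> {..<dim_col B}" "k < length is" "e < dim_row B"
  shows "stacked_cols B is $ (k * dim_row B + e) = B $$ (e, is ! k)"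
  using assms
proof (induction "is" arbitrary: k)
  case (Cons i "is")
  have cons: "stacked_cols B (i # is) = col B i @\<^sub>v stacked_cols B is"
    by (simp add: stacked_cols_def)
  have len: "k * dim_row B + e < length (i # is) * dim_row B"
  proof -
    have "k * dim_row B + e < Suc k * dim_row B" using Cons.prems(3) by simp
    also have "\<dots> \<le> length (i # is) * dim_row B"
      using Cons.prems(2) by (intro mult_le_mono1) simp
    finally show ?thesis .
  qed
  show ?case
  proof (cases k)
    case 0
    then show ?thesis using Cons.prems len unfolding cons
      by (simp add: stacked_cols_dim)
  next
    case (Suc k')
    have "stacked_cols B (i # is) $ (k * dim_row B + e) = stacked_cols B is $ (k' * dim_row B + e)"
      using len unfolding cons by (simp add: stacked_cols_dim Suc)
    then show ?thesis using Cons.IH[of k'] Cons.prems Suc by simp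
  qed
qed simp

section \<open>Markov bases of toric fiber powers\<close>

locale toric_fiber_powers =
  fixes B :: "int mat" and \<phi> :: "nat \<Rightarrow> nat" and d n t :: nat
  assumes B: "B \<in> carrier_mat d n" and surj: "\<phi> ` {..<n} = {..<t}"
begin

sublocale graded_weights "{..<n}" \<phi> "col_fun B"
  by unfold_locales simp

lemma set_fiber_tuples: "set (fiber_tuples \<phi> r n) = tuples r"
  by (auto simp: fiber_tuples_def set_n_lists tuples_def)

lemma distinct_fiber_tuples: "distinct (fiber_tuples \<phi> r n)"
  by (simp add: fiber_tuples_def distinct_n_lists)

lemma dim_col_power: "dim_col (toric_fiber_power \<phi> r B) = length (fiber_tuples \<phi> r n)"
  using B by (simp add: toric_fiber_power_def)

lemma power_mult_index:
  assumes X: "set_mset X \<subseteq> tuples r" and "k < r" "e < d"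
  shows "(toric_fiber_power \<phi> r B *\<^sub>v count_vec (fiber_tuples \<phi> r n) X) $ (k * d + e) =
    weight (column k X) e"
proof -
  have "Suc k * d \<le> r * d" using \<open>k < r\<close> by (intro mult_le_mono1) simp
  then have less: "k * d + e < r * d" using \<open>e < d\<close> by simp
  have "(toric_fiber_power \<phi> r B *\<^sub>v count_vec (fiber_tuples \<phi> r n) X) $ (k * d + e) =
    (\<Sum>l\<in>#X. col_fun B (l ! k) e)"
  proof (rule mult_count_vec_index[where m = "r * d"])
    fix c assume c: "c < length (fiber_tuples \<phi> r n)"
    let ?l = "fiber_tuples \<phi> r n ! c"
    have "?l \<in> tuples r" using nth_mem[OF c] by (simp add: set_fiber_tuples)
    then have "length ?l = r" "set ?l \<subseteq> {..<n}" by (auto simp: tuples_def)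
    then show "toric_fiber_power \<phi> r B $$ (k * d + e, c) = col_fun B (?l ! k) e"
      using stacked_cols_index[of ?l B k e] B c less \<open>k < r\<close> \<open>e < d\<close>
      by (auto simp: toric_fiber_power_def mat_of_cols_index col_fun_def)
  qed (use X less B in \<open>auto simp: set_fiber_tuples distinct_fiber_tuples toric_fiber_power_def\<close>)
  also have "\<dots> = weight (column k X) e"
    by (simp add: sum_mset_fun_apply column_def multiset.map_comp comp_def)
  finally show ?thesis .
qed

text \<open>
  Row \<open>k * d + e\<close> of the fiber power evaluates row \<open>e\<close> of \<open>B\<close> on column \<open>k\<close> of the table, and every
  row index has this form. Hence the fiber of a point depends only on the column weights, which steps
  preserve.
\<close>

lemma power_mult_eq_iff:
  assumes X: "set_mset X \<subseteq> tuples r" and Y: "set_mset Y \<subseteq> tuples r"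
  shows "toric_fiber_power \<phi> r B *\<^sub>v count_vec (fiber_tuples \<phi> r n) X =
      toric_fiber_power \<phi> r B *\<^sub>v count_vec (fiber_tuples \<phi> r n) Y \<longleftrightarrow>
    (\<forall>k<r. weight (column k X) = weight (column k Y))"
    (is "?x = ?y \<longleftrightarrow> ?W")
proof
  assume eq: "?x = ?y"
  show ?W
  proof (intro allI impI ext)
    fix k e assume k: "k < r"
    show "weight (column k X) e = weight (column k Y) e"
    proof (cases "e < d")
      case True
      then show ?thesis using power_mult_index[OF X k] power_mult_index[OF Y k] eq by simp
    next
      case False
      then show ?thesis using B by (simp add: sum_mset_fun_apply col_fun_def)
    qed
  qed
next
  assume W: ?W
  have dim: "dim_row (toric_fiber_power \<phi> r B) = r * d"
    using B by (simp add: toric_fiber_power_def)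
  show "?x = ?y"
  proof (rule eq_vecI)
    fix i assume "i < dim_vec ?y"
    then have i: "i < r * d" by (simp add: dim)
    then have "d > 0" by (cases d) auto
    then have "i div d < r" "i mod d < d" using i by (simp_all add: less_mult_imp_div_less)
    then show "?x $ i = ?y $ i"
      using power_mult_index[OF X, of "i div d" "i mod d"] power_mult_index[OF Y, of "i div d" "i mod d"] W
      by simp
  qed simp
qed

lemma fiber_powerE:
  assumes "u \<in> fiber (toric_fiber_power \<phi> r B) b"
  obtains X where "set_mset X \<subseteq> tuples r" "u = count_vec (fiber_tuples \<phi> r n) X"
    "toric_fiber_power \<phi> r B *\<^sub>v count_vec (fiber_tuples \<phi> r n) X = b"
proof -
  have "u \<in> nonneg_vecs (length (fiber_tuples \<phi> r n))"
    using assms by (simp add: fiber_def dim_col_power)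
  then obtain X where "set_mset X \<subseteq> set (fiber_tuples \<phi> r n)" "count_vec (fiber_tuples \<phi> r n) X = u"
    by (rule count_vec_surj[OF distinct_fiber_tuples])
  with assms show ?thesis by (intro that) (auto simp: set_fiber_tuples fiber_def)
qed

lemma steps_imp_fiber_path:
  assumes "(X, Y) \<in> (steps r K)\<^sup>*" and X: "set_mset X \<subseteq> tuples r"
    and Xb: "toric_fiber_power \<phi> r B *\<^sub>v count_vec (fiber_tuples \<phi> r n) X = b"
  shows "(count_vec (fiber_tuples \<phi> r n) X, count_vec (fiber_tuples \<phi> r n) Y) \<in>
    (fiber_graph {v \<in> carrier_vec (length (fiber_tuples \<phi> r n)). vec_deg v \<le> K}
      (fiber (toric_fiber_power \<phi> r B) b))\<^sup>*"
  using assms(1)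
proof (induction rule: rtrancl_induct)
  case (step Y Y')
  let ?xs = "fiber_tuples \<phi> r n" and ?F = "fiber (toric_fiber_power \<phi> r B) b"
  have in_fiber: "count_vec ?xs Z \<in> ?F" if "(X, Z) \<in> (steps r K)\<^sup>*" for Z
    using power_mult_eq_iff[OF X steps_rtrancl_tuples[OF that X]] steps_rtrancl_weight[OF that] Xb
    by (simp add: fiber_def count_vec_nonneg dim_col_power)
  obtain P Q R where PQ: "Y = P + R" "Y' = Q + R" "size P \<le> K" "size Q \<le> K"
    and "set_mset Y \<subseteq> tuples r" "set_mset Y' \<subseteq> tuples r"
    using step.hyps(2) by (auto simp: steps_def)
  then have "vec_deg (count_vec ?xs Y - count_vec ?xs Y') \<le> max (size P) (size Q)"
    unfolding PQ by (intro vec_deg_count_vec_diff) (auto simp: distinct_fiber_tuples set_fiber_tuples)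
  then have "vec_deg (count_vec ?xs Y - count_vec ?xs Y') \<le> K"
    using PQ by simp
  moreover have "count_vec ?xs Y - count_vec ?xs Y' \<in> carrier_vec (length ?xs)" by simp
  moreover have "(X, Y') \<in> (steps r K)\<^sup>*" using step.hyps by (rule rtrancl_into_rtrancl)
  ultimately have "(count_vec ?xs Y, count_vec ?xs Y') \<in> fiber_graph
      {v \<in> carrier_vec (length ?xs). vec_deg v \<le> K} ?F"
    using in_fiber[OF step.hyps(1)] in_fiber[of Y'] unfolding fiber_graph_def by blast
  with step.IH show ?case by (rule rtrancl_into_rtrancl)
qed simp

definition column_fibers :: "nat \<Rightarrow> nat list multiset \<Rightarrow> int vec set" where
  "column_fibers r X = (\<Inter>k\<in>{..<r}. induced_map t \<phi> ` fiber B (B *\<^sub>v count_vec [0..<n] (column k X)))"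

lemma column_fibers_in_family:
  assumes "r > 0"
  shows "column_fibers r X \<in> intersected_projected_fibers t \<phi> B"
proof -
  have "B *\<^sub>v count_vec [0..<n] U \<in> affine_semigroup B" for U
    using B count_vec_nonneg[of "[0..<n]" U] unfolding affine_semigroup_def by auto
  then show ?thesis
    using assms unfolding column_fibers_def intersected_projected_fibers_def
    by (intro CollectI exI[of _ r] exI[of _ "\<lambda>k. B *\<^sub>v count_vec [0..<n] (column k X)"]) auto
qed

lemma classes_in_column_fibers:
  assumes X: "set_mset X \<subseteq> tuples r" and Y: "set_mset Y \<subseteq> tuples r"
    and wts: "\<forall>k<r. weight (column k X) = weight (column k Y)"
  shows "count_vec [0..<t] (image_mset \<phi> (column 0 Y)) \<in> column_fibers r X"
  unfolding column_fibers_def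
proof (intro INT_I)
  fix k assume "k \<in> {..<r}"
  then have k: "k < r" by simp
  have "count_vec [0..<n] (column k Y) \<in> fiber B (B *\<^sub>v count_vec [0..<n] (column k X))"
    using wts k B count_vec_nonneg[of "[0..<n]"] set_column[OF X k] set_column[OF Y k]
    by (auto simp: fiber_def mult_count_vec)
  moreover have "count_vec [0..<t] (image_mset \<phi> (column 0 Y)) = induced_map t \<phi> (count_vec [0..<n] (column k Y))"
    using induced_map_count_vec[OF surj set_column[OF Y k]] classes_column[OF Y k] by simp
  ultimately show "count_vec [0..<t] (image_mset \<phi> (column 0 Y)) \<in>
    induced_map t \<phi> ` fiber B (B *\<^sub>v count_vec [0..<n] (column k X))" by blast
qed

lemma in_column_fibersE:
  assumes "r > 0" and X: "set_mset X \<subseteq> tuples r" and w: "w \<in> column_fibers r X"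
  obtains W where "set_mset W \<subseteq> {..<t}" "w = count_vec [0..<t] W" "W \<in> common_classes r X"
proof -
  have ex: "\<exists>U. set_mset U \<subseteq> {..<n} \<and> weight U = weight (column k X) \<and> w = count_vec [0..<t] (image_mset \<phi> U)"
    if k: "k < r" for k
  proof -
    from w k obtain u where u: "u \<in> fiber B (B *\<^sub>v count_vec [0..<n] (column k X))" "w = induced_map t \<phi> u"
      unfolding column_fibers_def by blast
    then have "u \<in> nonneg_vecs (length [0..<n])" using B by (simp add: fiber_def)
    then obtain U where U: "set_mset U \<subseteq> set [0..<n]" "count_vec [0..<n] U = u"
      by (rule count_vec_surj[OF distinct_upt])
    then have U': "set_mset U \<subseteq> {..<n}" by auto
    have "B *\<^sub>v count_vec [0..<n] U = B *\<^sub>v count_vec [0..<n] (column k X)"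
      using u(1) U(2) by (simp add: fiber_def)
    then have "weight U = weight (column k X)"
      by (simp add: mult_count_vec[OF B U'] mult_count_vec[OF B set_column[OF X k]] vec_col_fun_eq_iff[OF B])
    with U' U(2) u(2) induced_map_count_vec[OF surj U'] show ?thesis by auto
  qed
  have img: "set_mset (image_mset \<phi> U) \<subseteq> set [0..<t]" if "set_mset U \<subseteq> {..<n}" for U
    using image_mono[OF that, of \<phi>] by (simp add: surj atLeast0LessThan)
  from ex[OF \<open>r > 0\<close>] obtain U where U: "set_mset U \<subseteq> {..<n}" "w = count_vec [0..<t] (image_mset \<phi> U)"
    by blast
  have "image_mset \<phi> U \<in> common_classes r X"
    unfolding common_classes_def
  proof (intro CollectI allI impI)
    fix k assume "k < r"
    then obtain V where V: "set_mset V \<subseteq> {..<n}" "weight V = weight (column k X)"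
      "w = count_vec [0..<t] (image_mset \<phi> V)" using ex by blast
    have "image_mset \<phi> V = image_mset \<phi> U"
      using count_vec_inj[OF img[OF V(1)] img[OF U(1)]] V(3) U(2) by simp
    with V show "\<exists>V. set_mset V \<subseteq> {..<n} \<and> weight V = weight (column k X) \<and> image_mset \<phi> V = image_mset \<phi> U"
      by blast
  qed
  then show ?thesis using that[of "image_mset \<phi> U"] img[OF U(1)] U(2) by (simp add: atLeast0LessThan)
qed

text \<open>
  An edge from \<open>u\<close> to \<open>v\<close> of a fiber graph is labelled by \<open>u - v\<close>, whereas the class graph uses the
  target minus the source; hence the sign.
\<close>

definition coeff_funs :: "int vec set \<Rightarrow> (nat \<Rightarrow> int) set" where
  "coeff_funs G = (\<lambda>g j. if j < t then - g $ j else 0) ` (G \<union> uminus ` G)"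

lemma fiber_path_imp_class_path:
  assumes "r > 0" and X: "set_mset X \<subseteq> tuples r"
    and "(count_vec [0..<t] W, count_vec [0..<t] W') \<in> (fiber_graph G (column_fibers r X))\<^sup>*"
    and W: "set_mset W \<subseteq> {..<t}" and W': "set_mset W' \<subseteq> {..<t}"
  shows "(W, W') \<in> (class_graph (coeff_funs G) (common_classes r X))\<^sup>*"
proof -
  have "\<exists>V. set_mset V \<subseteq> {..<t} \<and> w = count_vec [0..<t] V \<and>
      (W, V) \<in> (class_graph (coeff_funs G) (common_classes r X))\<^sup>*"
    if "(count_vec [0..<t] W, w) \<in> (fiber_graph G (column_fibers r X))\<^sup>*" for w
    using that
  proof (induction rule: rtrancl_induct)
    case base
    show ?case using W by blast
  next
    case (step w w')
    from step.IH obtain V where V: "set_mset V \<subseteq> {..<t}" "w = count_vec [0..<t] V"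
      "(W, V) \<in> (class_graph (coeff_funs G) (common_classes r X))\<^sup>*" by blast
    have fib: "w \<in> column_fibers r X" "w' \<in> column_fibers r X" and diff: "w - w' \<in> G \<union> uminus ` G"
      using step.hyps(2) by (auto simp: fiber_graph_def)
    obtain V1 where V1: "set_mset V1 \<subseteq> {..<t}" "w = count_vec [0..<t] V1" "V1 \<in> common_classes r X"
      by (rule in_column_fibersE[OF \<open>r > 0\<close> X fib(1)])
    obtain V' where V': "set_mset V' \<subseteq> {..<t}" "w' = count_vec [0..<t] V'" "V' \<in> common_classes r X"
      by (rule in_column_fibersE[OF \<open>r > 0\<close> X fib(2)])
    have "V1 = V"
      using count_vec_inj[of V1 "[0..<t]" V] V(1,2) V1(1,2) by (simp add: atLeast0LessThan)
    have "(\<lambda>j. int (count V' j) - int (count V j)) = (\<lambda>j. if j < t then - (w - w') $ j else 0)"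
    proof
      fix j
      show "int (count V' j) - int (count V j) = (if j < t then - (w - w') $ j else 0)"
      proof (cases "j < t")
        case True
        then show ?thesis by (simp add: V(2) V'(2))
      next
        case False
        then have "j \<notin># V" "j \<notin># V'" using V(1) V'(1) by auto
        then show ?thesis using False by (simp add: not_in_iff)
      qed
    qed
    then have "(\<lambda>j. int (count V' j) - int (count V j)) \<in> coeff_funs G"
      using diff unfolding coeff_funs_def by blast
    then have "(V, V') \<in> class_graph (coeff_funs G) (common_classes r X)"
      using V1(3) V'(3) \<open>V1 = V\<close> by (simp add: class_graph_def)
    with V(3) have "(W, V') \<in> (class_graph (coeff_funs G) (common_classes r X))\<^sup>*"
      by (rule rtrancl_into_rtrancl)
    with V' show ?case by blast
  qed
  from this[OF assms(3)] obtain V where V: "set_mset V \<subseteq> {..<t}"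
    "count_vec [0..<t] W' = count_vec [0..<t] V"
    "(W, V) \<in> (class_graph (coeff_funs G) (common_classes r X))\<^sup>*" by blast
  have "W' = V"
    using count_vec_inj[of W' "[0..<t]" V] V(1,2) W' by (simp add: atLeast0LessThan)
  with V(3) show ?thesis by simp
qed

text \<open>
  The vectors of degree at most \<open>K\<close> form a Markov basis of every fiber power. They need not lie in the
  kernel, because an edge of a fiber graph joins two points of the same fiber in any case.
\<close>

lemma markov_basis_of_bounded_degree:
  assumes "markov_basis t (intersected_projected_fibers t \<phi> B) G" and "finite G"
  obtains K where "\<And>r. r > 0 \<Longrightarrow> markov_basis (dim_col (toric_fiber_power \<phi> r B))
    (all_fibers (toric_fiber_power \<phi> r B))
    {v \<in> carrier_vec (dim_col (toric_fiber_power \<phi> r B)). vec_deg v \<le> K}"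
proof -
  have "finite (coeff_funs G)" using assms(2) by (simp add: coeff_funs_def)
  then obtain K where K: "\<And>r X Y. r > 0 \<Longrightarrow> set_mset X \<subseteq> tuples r \<Longrightarrow> set_mset Y \<subseteq> tuples r \<Longrightarrow>
     \<forall>k<r. weight (column k X) = weight (column k Y) \<Longrightarrow>
     (image_mset \<phi> (column 0 X), image_mset \<phi> (column 0 Y)) \<in>
       (class_graph (coeff_funs G) (common_classes r X))\<^sup>* \<Longrightarrow>
     (X, Y) \<in> (steps r K)\<^sup>*"
    by (rule tables_connected) (rule that)
  show ?thesis
  proof (rule that[of K])
    fix r :: nat assume r: "r > 0"
    let ?P = "toric_fiber_power \<phi> r B"
    let ?M = "{v \<in> carrier_vec (dim_col ?P). vec_deg v \<le> K}"
    have "(u, v) \<in> (fiber_graph ?M (fiber ?P b))\<^sup>*" if u: "u \<in> fiber ?P b" and v: "v \<in> fiber ?P b" for u v b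
    proof -
      obtain X where X: "set_mset X \<subseteq> tuples r" "u = count_vec (fiber_tuples \<phi> r n) X"
        "?P *\<^sub>v count_vec (fiber_tuples \<phi> r n) X = b"
        by (rule fiber_powerE[OF u])
      obtain Y where Y: "set_mset Y \<subseteq> tuples r" "v = count_vec (fiber_tuples \<phi> r n) Y"
        "?P *\<^sub>v count_vec (fiber_tuples \<phi> r n) Y = b"
        by (rule fiber_powerE[OF v])
      have wts: "\<forall>k<r. weight (column k X) = weight (column k Y)"
        using power_mult_eq_iff[OF X(1) Y(1)] X(3) Y(3) by simp
      have classes: "set_mset (image_mset \<phi> (column 0 Z)) \<subseteq> {..<t}" if "set_mset Z \<subseteq> tuples r" for Z
        using image_mono[OF set_column[OF that r], of \<phi>] by (simp add: surj)
      have "(count_vec [0..<t] (image_mset \<phi> (column 0 X)), count_vec [0..<t] (image_mset \<phi> (column 0 Y)))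
          \<in> (fiber_graph G (column_fibers r X))\<^sup>*"
        using assms(1) column_fibers_in_family[OF r, of X]
          classes_in_column_fibers[OF X(1) X(1)] classes_in_column_fibers[OF X(1) Y(1) wts]
        unfolding markov_basis_def by blast
      then have "(image_mset \<phi> (column 0 X), image_mset \<phi> (column 0 Y)) \<in>
          (class_graph (coeff_funs G) (common_classes r X))\<^sup>*"
        by (rule fiber_path_imp_class_path[OF r X(1) _ classes[OF X(1)] classes[OF Y(1)]])
      with K r X(1) Y(1) wts have "(X, Y) \<in> (steps r K)\<^sup>*" by blast
      then show ?thesis
        unfolding X(2) Y(2) dim_col_power by (rule steps_imp_fiber_path[OF _ X(1,3)])
    qed
    then show "markov_basis (dim_col ?P) (all_fibers ?P) ?M"
      unfolding markov_basis_def all_fibers_def by blast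
  qed
qed

end

theorem theorem52:
  fixes A B :: "int mat" and \<phi> :: "nat \<Rightarrow> nat" and G :: "int vec set" and s t d n :: nat
  assumes "A \<in> carrier_mat s t"
    and "B \<in> carrier_mat d n"
    and "\<phi> ` {..<n} = {..<t}"
    and "graded_by A \<phi> B"
    and "markov_basis t (intersected_projected_fibers t \<phi> B) G"
    and "finite G"
  shows "\<exists>C::nat. C > 0 \<and> (\<forall>r>0. mardeg (toric_fiber_power \<phi> r B) \<le> enat C)"
proof -
  interpret toric_fiber_powers B \<phi> d n t
    using assms(2,3) by unfold_locales
  obtain K where K: "\<And>r. r > 0 \<Longrightarrow> markov_basis (dim_col (toric_fiber_power \<phi> r B))
    (all_fibers (toric_fiber_power \<phi> r B))
    {v \<in> carrier_vec (dim_col (toric_fiber_power \<phi> r B)). vec_deg v \<le> K}"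
    by (rule markov_basis_of_bounded_degree[OF assms(5,6)]) (rule that)
  have "mardeg (toric_fiber_power \<phi> r B) \<le> enat (Suc K)" if "r > 0" for r
  proof -
    let ?M = "{v \<in> carrier_vec (dim_col (toric_fiber_power \<phi> r B)). vec_deg v \<le> K}"
    have "mardeg (toric_fiber_power \<phi> r B) \<le> set_deg ?M"
      unfolding mardeg_def using K[OF that] by (intro Inf_lower) blast
    also have "\<dots> \<le> enat (Suc K)"
      unfolding set_deg_def by (intro SUP_least) auto
    finally show ?thesis .
  qed
  then show ?thesis by blast
qed

end
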